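(* Let $\mathbb{K}$ be an imaginary quadratic field with ring of integers $\mathcal{O}_{\mathbb{K}}$ and let $n\geq3$ be a rational integer. Let $a$ and $b$ be algebraic integers in $\mathbb{K}$ with the ideal $(a,b)=\mathcal{O}_{\mathbb{K}}$ and either $a/b>1$ a rational number or $|a/b|=1$ with $a/b\neq-1$. Let $d$ be the largest positive rational integer such that $(a-b)/d$ is an algebraic integer. Let $\mathcal{C}_{n}$ and $\mathcal{D}_{n}$ be positive real numbers such that $$\max\left(1,\frac{\Gamma(1-1/n)\,r!}{\Gamma(r+1-1/n)},\frac{n\Gamma(r+1+1/n)}{\Gamma(1/n)\,r!}\right)\frac{D_{n,r}}{N_{d,n,r}}<\mathcal{C}_{n}\left(\frac{\mathcal{D}_{n}}{\mathcal{N}_{d,n}}\right)^{r}$$ holds for all non-negative integers $r$. Put $$E=\frac{\mathcal{N}_{d,n}}{\mathcal{D}_{n}}\left\{\min\left(\left|\sqrt{a}-\sqrt{b}\right|,\left|\sqrt{a}+\sqrt{b}\right|\right)\right\}^{-2},\qquad Q=\frac{\mathcal{D}_{n}}{\mathcal{N}_{d,n}}\left\{\max\left(\left|\sqrt{a}-\sqrt{b}\right|,\left|\sqrt{a}+\sqrt{b}\right|\right)\right\}^{2},$$ $$\kappa=\frac{\log Q}{\log E},\qquad c=4|a|\,\mathcal{C}_{n}Q\left(2.5\left|\frac{a(a-b)}{b}\right|\mathcal{C}_{n}E\right)^{\kappa}.$$ If $E>1$, then $$\left|(a/b)^{1/n}-\frac{p}{q}\right|>\frac{1}{c|q|^{\kappa+1}}$$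 for all algebraic integers $p$ and $q$ in $\mathbb{K}$ with $q\neq0$.
   Context: All fields are subfields of $\mathbb{C}$. For a complex number $w=se^{i\varphi}$ with $s\geq0$, $-\pi<\varphi\leq\pi$ (and $\varphi=0$ if $s=0$), $w^{1/n}$ denotes $s^{1/n}e^{i\varphi/n}$, where $s^{1/n}$ is the non-negative real $n$-th root; $\sqrt{w}=w^{1/2}$. For a positive integer $n\ge 2$ and a non-negative integer $r$, $X_{n,r}(x)={}_2F_1(-r,-r-1/n;1-1/n;x)$, a polynomial of degree $r$ with rational coefficients (${}_2F_1$ is the classical Gauss hypergeometric function). $D_{n,r}$ is the smallest positive integer such that $D_{n,r}X_{n,r}(x)$ has rational integer coefficients. For a positive integer $d$, $N_{d,n,r}$ is the greatest common divisor of the numerators (in lowest terms) of the coefficients of the polynomial $X_{n,r}(1-dx)$. With $v_p$ the $p$-adic valuation, $\mathcal{N}_{d,n}=\prod_{p\mid n}p^{\min(v_p(d),\,v_p(n)+1/(p-1))}$, the product over primes $p$ dividing $n$. It is understood that $b\ne0$ and $a\neq b$, so that $d$ and $E$ are defined. *)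

theory Defs
  imports
    "HOL-Analysis.Analysis"
    "HOL-Computational_Algebra.Polynomial_FPS"
begin

definition is_subfield :: "complex set \<Rightarrow> bool" where
  "is_subfield K \<longleftrightarrow> 0 \<in> K \<and> 1 \<in> K \<and>
     (\<forall>x\<in>K. \<forall>y\<in>K. x + y \<in> K \<and> x * y \<in> K) \<and>
     (\<forall>x\<in>K. - x \<in> K \<and> inverse x \<in> K)"

abbreviation rat_scale :: "rat \<Rightarrow> complex \<Rightarrow> complex" where
  "rat_scale q z \<equiv> of_rat q * z"

lemma vector_space_rat_scale: "vector_space rat_scale"
  by unfold_locales (simp_all add: algebra_simps of_rat_add of_rat_mult)

text \<open>A subfield of the complex numbers of degree 2 over the rationals that is not real.
  (The library dimension is 0 for infinite-dimensional spaces, so the value 2 is meaningful.)\<close>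

definition imaginary_quadratic_field :: "complex set \<Rightarrow> bool" where
  "imaginary_quadratic_field K \<longleftrightarrow>
     is_subfield K \<and> vector_space.dim rat_scale K = 2 \<and> \<not> K \<subseteq> \<real>"

definition ring_of_integers :: "complex set \<Rightarrow> complex set" where
  "ring_of_integers K = {x \<in> K. algebraic_int x}"

definition ideal2 :: "complex set \<Rightarrow> complex \<Rightarrow> complex \<Rightarrow> complex set" where
  "ideal2 R a b = {a * x + b * y | x y. x \<in> R \<and> y \<in> R}"

text \<open>The principal root, with argument in the half-open interval from \<open>-pi\<close> (excluded)
  to \<open>pi\<close> (included); \<open>Arg 0 = 0\<close>.\<close>

definition princ_root :: "nat \<Rightarrow> complex \<Rightarrow> complex" where
  "princ_root n w = of_real (root n (cmod w)) * cis (Arg w / real n)"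

lemma princ_root_eq_powr:
  assumes "n > 0"
  shows "princ_root n w = w powr (1 / of_nat n)"
proof (cases "w = 0")
  case True
  then show ?thesis by (simp add: princ_root_def)
next
  case False
  have "w powr (1 / of_nat n) =
      exp (of_real (ln (cmod w) / real n) + \<i> * of_real (Arg w / real n))"
    using False by (simp add: powr_def Ln_Arg add_divide_distrib)
  also have "\<dots> = of_real (exp (ln (cmod w) / real n)) * cis (Arg w / real n)"
    by (simp only: exp_add exp_of_real cis_conv_exp)
  also have "exp (ln (cmod w) / real n) = root n (cmod w)"
    using False assms by (simp add: root_powr_inverse powr_def field_simps)
  finally show ?thesis by (simp add: princ_root_def)
qed

lemma princ_root_2: "princ_root 2 w = csqrt w"
  by (simp add: princ_root_eq_powr csqrt_conv_powr)

text \<open>The hypergeometric series with upper parameter \<open>-r\<close> terminates at degree \<open>r\<close>, so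
  truncating it loses nothing; see \<open>fps_of_poly_hyp_X\<close> below.\<close>

definition hyp_X :: "nat \<Rightarrow> nat \<Rightarrow> rat poly" where
  "hyp_X n r = truncate_fps (Suc r)
     (fps_hypergeo [- of_nat r, - of_nat r - 1 / of_nat n] [1 - 1 / of_nat n] 1)"

lemma fps_of_poly_hyp_X:
  "fps_of_poly (hyp_X n r) =
     fps_hypergeo [- of_nat r, - of_nat r - 1 / of_nat n] [1 - 1 / of_nat n] 1"
proof (rule fps_ext)
  fix k
  show "fps_nth (fps_of_poly (hyp_X n r)) k = fps_nth
     (fps_hypergeo [- of_nat r, - of_nat r - 1 / of_nat n] [1 - 1 / of_nat n] 1) k"
    by (cases "k < Suc r")
       (simp_all add: hyp_X_def coeff_truncate_fps pochhammer_of_nat_eq_0_lemma)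
qed

definition hyp_D :: "nat \<Rightarrow> nat \<Rightarrow> nat" where
  "hyp_D n r = (LEAST D. D > 0 \<and> (\<forall>i. coeff (smult (of_nat D) (hyp_X n r)) i \<in> \<int>))"

text \<open>Vanishing coefficients have numerator 0 and do not affect the greatest common divisor.\<close>

definition hyp_N :: "nat \<Rightarrow> nat \<Rightarrow> nat \<Rightarrow> int" where
  "hyp_N d n r =
     (let P = pcompose (hyp_X n r) [:1, - of_nat d:]
      in Gcd ((\<lambda>i. fst (quotient_of (coeff P i))) ` {..degree P}))"

definition cal_N :: "nat \<Rightarrow> nat \<Rightarrow> real" where
  "cal_N d n = (\<Prod>p\<in>prime_factors n. real p powr
     min (real (multiplicity p d)) (real (multiplicity p n) + 1 / (real p - 1)))"

end

theory Submission
  imports Defs "Jordan_Normal_Form.Char_Poly"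
begin

text \<open>
  Write \<open>\<nu> = 1/n\<close>, \<open>x = a/b\<close>, and let \<open>X\<^sub>r\<close> be the hypergeometric polynomial. The function
  \<open>((1 - x/t) (1 - t)) ^ r * t powr (\<nu> - 1)\<close> has a primitive \<open>F\<close> made of the powers \<open>t powr (\<nu> + j)\<close>,
  \<open>-r \<le> j \<le> r\<close>. By partial fractions, \<open>X\<^sub>r(x)\<close> and \<open>x powr \<nu> * x^r * X\<^sub>r(1/x)\<close> are the same constant multiple
  of \<open>F(1)\<close> and \<open>F(x)\<close>. Hence the remainder is controlled by the size of the integrand between \<open>1\<close> and
  \<open>x\<close>, and \<open>X\<^sub>r\<close> itself by the size of the integrand on the circle of radius \<open>sqrt (cmod x)\<close>, because
  \<open>F\<close> is multiplied by \<open>exp (2 * pi * \<i> * \<nu>)\<close> along it. The determinant of two consecutive approximants is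
  a polynomial of degree at most \<open>2r + 1\<close> which the remainder estimate forces to vanish at \<open>1\<close> to
  order \<open>2r + 1\<close>, so it has no other zero. After clearing denominators the approximants are
  integers of the field, whose nonzero elements have absolute value at least \<open>1\<close>; of two consecutive
  ones, at least one differs from \<open>p/q\<close>.
\<close>

unbundle no vec_syntax

section \<open>Sums and products of algebraic integers\<close>

interpretation int_module: Modules.module "\<lambda>(k::int) (z::'a::comm_ring_1). of_int k * z"
  by unfold_locales (simp_all add: algebra_simps)

text \<open>The characteristic polynomial of an integer matrix is monic with integer coefficients,
  and the eigenvalue is a root of it.\<close>

lemma algebraic_int_eigenvalue:
  fixes A :: "int mat" and z :: "'a::field_char_0"
  assumes A: "A \<in> carrier_mat n n" and ev: "eigenvalue (map_mat of_int A) z"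
  shows "algebraic_int z"
proof -
  have A': "map_mat (of_int :: int \<Rightarrow> 'a) A \<in> carrier_mat n n" using A by simp
  have "poly (map_poly of_int (char_poly A)) z = 0"
    using ev eigenvalue_root_char_poly[OF A'] of_int_hom.char_poly_hom[OF A, where ?'a = 'a] by simp
  moreover have "lead_coeff (char_poly A) = 1"
    using degree_monic_char_poly[OF A] by simp
  ultimately show ?thesis by (auto simp: algebraic_int_altdef_ipoly)
qed

text \<open>Multiplication by \<open>z\<close> acts on the generators through an integer matrix
  \<open>A\<close>, so the vector of generators is an eigenvector of \<open>A\<close> for
  \<open>z\<close>. The generator \<open>g0\<close> makes that vector nonzero.\<close>

lemma algebraic_int_if_stable_span:
  fixes z :: "'a::field_char_0"
  assumes fin: "finite G" and ne: "g0 \<in> G" "g0 \<noteq> 0"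
    and stable: "\<And>g. g \<in> G \<Longrightarrow> z * g \<in> int_module.span G"
  shows "algebraic_int z"
proof -
  obtain gs where gs: "set gs = G" "distinct gs" using finite_distinct_list[OF fin] by blast
  define n where "n = length gs"
  have "\<forall>g\<in>G. \<exists>u. z * g = (\<Sum>h\<in>G. of_int (u h) * h)"
    using stable int_module.span_finite[OF fin] by blast
  then obtain u where u: "\<And>g. g \<in> G \<Longrightarrow> z * g = (\<Sum>h\<in>G. of_int (u g h) * h)" by metis
  define A where "A = mat n n (\<lambda>(i, j). u (gs ! i) (gs ! j))"
  define v where "v = vec n (\<lambda>i. gs ! i)"
  have A: "A \<in> carrier_mat n n" by (simp add: A_def)
  obtain i0 where i0: "i0 < n" "gs ! i0 = g0"
    using ne(1) gs(1) by (auto simp: in_set_conv_nth n_def)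
  have "v \<noteq> 0\<^sub>v n"
  proof
    assume "v = 0\<^sub>v n"
    then have "v $ i0 = 0" using i0 by simp
    then show False using i0 ne(2) by (simp add: v_def)
  qed
  moreover have "map_mat of_int A *\<^sub>v v = z \<cdot>\<^sub>v v"
  proof (rule eq_vecI)
    fix i assume "i < dim_vec (z \<cdot>\<^sub>v v)"
    then have i: "i < n" by (simp add: v_def)
    then have giG: "gs ! i \<in> G" using gs by (auto simp: n_def)
    have bij: "bij_betw (\<lambda>j. gs ! j) {..<n} G"
      using bij_betw_nth[OF gs(2)] gs(1) by (simp add: n_def)
    have "(map_mat of_int A *\<^sub>v v) $ i = (\<Sum>j<n. of_int (u (gs ! i) (gs ! j)) * gs ! j)"
      using i by (simp add: A_def v_def scalar_prod_def atLeast0LessThan)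
    also have "\<dots> = (\<Sum>h\<in>G. of_int (u (gs ! i) h) * h)"
      by (rule sum.reindex_bij_betw[OF bij])
    finally show "(map_mat of_int A *\<^sub>v v) $ i = (z \<cdot>\<^sub>v v) $ i"
      using u[OF giG] i by (simp add: v_def)
  qed (simp add: v_def A_def)
  ultimately have "eigenvalue (map_mat of_int A) z"
    unfolding eigenvalue_def eigenvector_def using A by (intro exI[of _ v]) (auto simp: v_def)
  then show ?thesis by (rule algebraic_int_eigenvalue[OF A])
qed

text \<open>Multiplication by \<open>z\<close> is additive and commutes with integer scalars. This
  lets multiplication by \<open>x\<close> follow multiplication by \<open>y\<close> in
  \<open>algebraic_int_mult\<close>.\<close>

lemma span_mult_stable:
  fixes z :: "'a::field_char_0"
  assumes "\<And>g. g \<in> G \<Longrightarrow> z * g \<in> int_module.span G" and "h \<in> int_module.span G"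
  shows "z * h \<in> int_module.span G"
  using assms(2)
proof (induction rule: int_module.span_induct_alt)
  case base
  show ?case by (simp only: mult_zero_right int_module.span_zero)
next
  case (step c x y)
  have "of_int c * (z * x) + z * y \<in> int_module.span G"
    by (rule int_module.span_add[OF int_module.span_scale[OF assms(1)[OF step(1)]] step(2)])
  then show ?case by (simp only: distrib_left mult.left_commute)
qed

lemma algebraic_int_imp_power_eq:
  fixes x :: "'a::field_char_0"
  assumes "algebraic_int x"
  obtains m c where "m > 0" and "x ^ m = (\<Sum>i<m. of_int (c i) * x ^ i)"
proof -
  obtain p where p: "poly (map_poly of_int p) x = 0" "lead_coeff p = 1"
    using assms by (auto simp: algebraic_int_altdef_ipoly)
  have deg: "degree (map_poly of_int p :: 'a poly) = degree p" by (intro degree_map_poly) auto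
  have "0 = (\<Sum>i\<le>degree p. of_int (coeff p i) * x ^ i)"
    using p(1) by (simp add: poly_altdef deg coeff_map_poly)
  also have "\<dots> = x ^ degree p + (\<Sum>i<degree p. of_int (coeff p i) * x ^ i)"
    using p(2) by (simp add: lessThan_Suc_atMost[symmetric])
  finally have "x ^ degree p = - (\<Sum>i<degree p. of_int (coeff p i) * x ^ i)"
    by (metis eq_neg_iff_add_eq_0)
  then have eq: "x ^ degree p = (\<Sum>i<degree p. of_int (- coeff p i) * x ^ i)"
    by (simp add: sum_negf)
  \<comment> \<open>A monic polynomial of degree 0 has no root: here \<open>eq\<close> would read
    \<open>1 = 0\<close>.\<close>
  have "degree p \<noteq> 0"
  proof
    assume deg: "degree p = 0"
    show False using eq unfolding deg by simp
  qed
  then show ?thesis by (intro that[OF _ eq]) simp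
qed

text \<open>The monomials \<open>x^i * y^j\<close> with \<open>i < m\<close> and
  \<open>j < n\<close> work: multiplying by \<open>x\<close> or \<open>y\<close> leaves this set
  only at the top exponent, where the monic equation lowers the power.\<close>

lemma algebraic_int_common_module:
  fixes x y :: "'a::field_char_0"
  assumes "algebraic_int x" and "algebraic_int y"
  obtains G where "finite G" "1 \<in> G"
    "\<And>g. g \<in> G \<Longrightarrow> x * g \<in> int_module.span G" "\<And>g. g \<in> G \<Longrightarrow> y * g \<in> int_module.span G"
proof -
  obtain m c where m: "m > 0" and c: "x ^ m = (\<Sum>i<m. of_int (c i) * x ^ i)"
    by (rule algebraic_int_imp_power_eq[OF assms(1)])
  obtain n d where n: "n > 0" and d: "y ^ n = (\<Sum>i<n. of_int (d i) * y ^ i)"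
    by (rule algebraic_int_imp_power_eq[OF assms(2)])
  define G where "G = (\<lambda>(i, j). x ^ i * y ^ j) ` ({..<m} \<times> {..<n})"
  have inG: "x ^ i * y ^ j \<in> G" if "i < m" "j < n" for i j
    using that unfolding G_def by (intro image_eqI[of _ _ "(i, j)"]) auto
  have "x * (x ^ i * y ^ j) \<in> int_module.span G" if ij: "i < m" "j < n" for i j
  proof (cases "Suc i = m")
    case True
    have "x * (x ^ i * y ^ j) = x ^ m * y ^ j" by (simp add: True[symmetric] mult_ac)
    also have "\<dots> = (\<Sum>k<m. of_int (c k) * (x ^ k * y ^ j))"
      unfolding c by (simp add: sum_distrib_right mult.assoc)
    also have "\<dots> \<in> int_module.span G"
      using ij by (intro int_module.span_sum int_module.span_scale int_module.span_base inG) auto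
    finally show ?thesis .
  next
    case False
    then have "x ^ Suc i * y ^ j \<in> int_module.span G"
      using ij by (intro int_module.span_base inG) auto
    then show ?thesis by (simp only: power_Suc mult.assoc)
  qed
  moreover have "y * (x ^ i * y ^ j) \<in> int_module.span G" if ij: "i < m" "j < n" for i j
  proof (cases "Suc j = n")
    case True
    have "y * (x ^ i * y ^ j) = x ^ i * y ^ n" by (simp add: True[symmetric] mult_ac)
    also have "\<dots> = (\<Sum>k<n. of_int (d k) * (x ^ i * y ^ k))"
      unfolding d by (simp add: sum_distrib_left algebra_simps)
    also have "\<dots> \<in> int_module.span G"
      using ij by (intro int_module.span_sum int_module.span_scale int_module.span_base inG) auto
    finally show ?thesis .
  next
    case False
    then have "x ^ i * y ^ Suc j \<in> int_module.span G"
      using ij by (intro int_module.span_base inG) auto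
    then show ?thesis by (simp only: power_Suc mult.left_commute)
  qed
  moreover have "finite G" "1 \<in> G" using inG[OF m n] inG[of 0 0] m n by (auto simp: G_def)
  ultimately show ?thesis by (intro that[of G]) (auto simp: G_def)
qed

lemma
  fixes x y :: "'a::field_char_0"
  assumes x: "algebraic_int x" and y: "algebraic_int y"
  shows algebraic_int_add: "algebraic_int (x + y)" and algebraic_int_mult: "algebraic_int (x * y)"
proof -
  obtain G where G: "finite G" "1 \<in> G" "\<And>g. g \<in> G \<Longrightarrow> x * g \<in> int_module.span G"
    "\<And>g. g \<in> G \<Longrightarrow> y * g \<in> int_module.span G"
    using algebraic_int_common_module[OF x y] by blast
  show "algebraic_int (x + y)"
    using G by (intro algebraic_int_if_stable_span[OF G(1,2)]) (auto simp: ring_distribs intro!: int_module.span_add)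
  show "algebraic_int (x * y)"
    using span_mult_stable[OF G(3)] G(4)
    by (intro algebraic_int_if_stable_span[OF G(1,2)]) (auto simp: mult.assoc)
qed

section \<open>Imaginary quadratic fields\<close>

interpretation rat_space: vector_space rat_scale
  by (rule vector_space_rat_scale)

text \<open>The space has dimension 2. Distinctness keeps the three coefficients apart when the
  relation is read off the set \<open>{x, y, z}\<close>.\<close>

lemma imaginary_quadratic_dependent:
  assumes K: "imaginary_quadratic_field K" and "x \<in> K" "y \<in> K" "z \<in> K"
    and dist: "x \<noteq> y" "x \<noteq> z" "y \<noteq> z"
  obtains r s t where "of_rat r * x + of_rat s * y + of_rat t * z = 0" "r \<noteq> 0 \<or> s \<noteq> 0 \<or> t \<noteq> 0"
proof -
  have dim: "rat_space.dim K = 2" using K by (simp add: imaginary_quadratic_field_def)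
  obtain B where B: "B \<subseteq> K" "rat_space.independent B" "K \<subseteq> rat_space.span B" "card B = 2"
    using rat_space.basis_exists[of K] dim by metis
  have finB: "finite B" using B(4) by (metis card.infinite zero_neq_numeral)
  have "rat_space.dependent {x, y, z}"
  proof (rule ccontr)
    assume "rat_space.independent {x, y, z}"
    then have "card {x, y, z} \<le> 2"
      using rat_space.independent_span_bound[OF finB, of "{x, y, z}"] B assms by auto
    then show False using dist by simp
  qed
  then obtain u v where u: "(\<Sum>v\<in>{x, y, z}. rat_scale (u v) v) = 0" and v: "v \<in> {x, y, z}" "u v \<noteq> 0"
    using rat_space.dependent_finite[of "{x, y, z}"] by auto
  show ?thesis
    using u v dist by (intro that[of "u x" "u y" "u z"]) (auto simp: add.assoc)
qed

lemma is_subfieldD: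
  assumes "is_subfield K"
  shows "0 \<in> K" "1 \<in> K" "x \<in> K \<Longrightarrow> y \<in> K \<Longrightarrow> x + y \<in> K" "x \<in> K \<Longrightarrow> y \<in> K \<Longrightarrow> x * y \<in> K"
    "x \<in> K \<Longrightarrow> - x \<in> K" "x \<in> K \<Longrightarrow> inverse x \<in> K"
  using assms by (auto simp: is_subfield_def)

text \<open>A real \<open>z\<close> is rational, since taking imaginary parts in a relation between
  1, \<open>z\<close> and a nonreal element of \<open>K\<close> removes the latter. A nonreal
  \<open>z\<close> and its conjugate are the two roots of a rational quadratic, whose product is
  rational.\<close>

lemma imaginary_quadratic_norm_rat:
  assumes K: "imaginary_quadratic_field K" and z: "z \<in> K"
  shows "z * cnj z \<in> \<rat>"
proof -
  have sub: "is_subfield K" using K by (simp add: imaginary_quadratic_field_def)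
  have ratRe [simp]: "Im (of_rat q) = 0" for q
    by (cases q) (simp add: of_rat_rat)
  have [simp]: "Re (of_rat q) = of_rat q" for q
    by (cases q) (simp add: of_rat_rat)
  show ?thesis
  proof (cases "z \<in> \<real>")
    case True
    obtain \<tau> where \<tau>: "\<tau> \<in> K" "\<tau> \<notin> \<real>" using K by (auto simp: imaginary_quadratic_field_def)
    have "z \<in> \<rat>"
    proof (cases "z = 1")
      case False
      have "\<tau> \<noteq> 1" "\<tau> \<noteq> z" using \<tau> True by auto
      then obtain r s t where *: "of_rat r * 1 + of_rat s * z + of_rat t * \<tau> = 0"
          "r \<noteq> 0 \<or> s \<noteq> 0 \<or> t \<noteq> 0"
        using imaginary_quadratic_dependent[OF K is_subfieldD(2)[OF sub] z \<tau>(1)] False by metis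
      have [simp]: "Im z = 0" "Im \<tau> \<noteq> 0" using True \<tau> by (auto simp: complex_is_Real_iff)
      have "Im (of_rat r * 1 + of_rat s * z + of_rat t * \<tau>) = 0" using * by simp
      then have "t = 0" by (auto simp: complex_eq_iff)
      with * have "s \<noteq> 0" by auto
      have "z = of_rat (- r / s)"
        using * \<open>t = 0\<close> \<open>s \<noteq> 0\<close> by (simp add: of_rat_divide of_rat_minus field_simps eq_neg_iff_add_eq_0)
      then show ?thesis by simp
    qed auto
    then show ?thesis using True by (auto elim!: Reals_cases)
  next
    case False
    have nr: "Im z \<noteq> 0" using False by (simp add: complex_is_Real_iff)
    have z2: "z * z \<in> K" using is_subfieldD(4)[OF sub z z] .
    have "z \<noteq> 1" "z \<noteq> z * z" "1 \<noteq> z * z"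
      using nr square_eq_1_iff[of z] by auto
    then obtain r s t where *: "of_rat r * 1 + of_rat s * z + of_rat t * (z * z) = 0"
        "r \<noteq> 0 \<or> s \<noteq> 0 \<or> t \<noteq> 0"
      using imaginary_quadratic_dependent[OF K is_subfieldD(2)[OF sub] z z2] by metis
    have "t \<noteq> 0"
    proof
      assume t: "t = 0"
      then have "Im (of_rat r * 1 + of_rat s * z) = 0" using * by simp
      then have "s = 0" using nr by (auto simp: complex_eq_iff)
      with * t show False by simp
    qed
    have cr: "cnj (of_rat q) = of_rat q" for q by (simp add: complex_eq_iff)
    have "cnj (of_rat r * 1 + of_rat s * z + of_rat t * (z * z)) = 0" using * by simp
    then have c: "of_rat r + of_rat s * cnj z + of_rat t * (cnj z * cnj z) = 0" by (simp add: cr)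
    \<comment> \<open>Weighting the equation for \<open>cnj z\<close> by \<open>z\<close> and the
      one for \<open>z\<close> by \<open>cnj z\<close> eliminates the linear coefficient
      \<open>s\<close>.\<close>
    have "(z - cnj z) * (of_rat r - of_rat t * (z * cnj z)) = 
        z * (of_rat r + of_rat s * cnj z + of_rat t * (cnj z * cnj z)) -
        cnj z * (of_rat r * 1 + of_rat s * z + of_rat t * (z * z))" 
      by (simp add: algebra_simps)
    then have "(z - cnj z) * (of_rat r - of_rat t * (z * cnj z)) = 0"
      unfolding c *(1) by simp
    moreover have "z - cnj z \<noteq> 0" using nr by (simp add: complex_eq_iff)
    ultimately have "of_rat r = of_rat t * (z * cnj z)" by simp
    then have "z * cnj z = of_rat (r / t)" using \<open>t \<noteq> 0\<close> by (simp add: of_rat_divide field_simps)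
    then show ?thesis by simp
  qed
qed

text \<open>The norm \<open>z * cnj z\<close> is a rational algebraic integer, hence a rational
  integer, and it is positive.\<close>

lemma ring_of_integers_norm_ge_1:
  assumes K: "imaginary_quadratic_field K" and z: "z \<in> ring_of_integers K" "z \<noteq> 0"
  shows "cmod z \<ge> 1"
proof -
  have "z \<in> K" and ai: "algebraic_int z" using z by (auto simp: ring_of_integers_def)
  then have "z * cnj z \<in> \<int>"
    using imaginary_quadratic_norm_rat[OF K] algebraic_int_mult[of z "cnj z"]
    by (intro rational_algebraic_int_is_int) auto
  then obtain k where k: "z * cnj z = of_int k" by (auto elim: Ints_cases)
  have "of_real ((cmod z)\<^sup>2) = (of_int k :: complex)"
    using k unfolding complex_norm_square .
  then have k': "(cmod z)\<^sup>2 = of_int k" by (metis of_real_eq_iff of_real_of_int_eq)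
  moreover have "(cmod z)\<^sup>2 > 0" using z by simp
  ultimately have "(cmod z)\<^sup>2 \<ge> 1" by simp
  then show ?thesis by (simp add: abs_square_less_1 flip: not_less)
qed

lemma
  assumes "is_subfield K"
  shows ring_of_integers_add: "x \<in> ring_of_integers K \<Longrightarrow> y \<in> ring_of_integers K \<Longrightarrow> x + y \<in> ring_of_integers K"
    and ring_of_integers_mult: "x \<in> ring_of_integers K \<Longrightarrow> y \<in> ring_of_integers K \<Longrightarrow> x * y \<in> ring_of_integers K"
    and ring_of_integers_diff: "x \<in> ring_of_integers K \<Longrightarrow> y \<in> ring_of_integers K \<Longrightarrow> x - y \<in> ring_of_integers K"
    and ring_of_integers_of_int: "of_int k \<in> ring_of_integers K"
proof -
  have nat: "of_nat m \<in> K" for m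
    by (induction m) (auto intro: is_subfieldD[OF assms])
  have "of_int k \<in> K"
  proof (cases k)
    case (nonneg m)
    then show ?thesis using nat[of m] by simp
  next
    case (neg m)
    then show ?thesis using is_subfieldD(5)[OF assms nat[of "Suc m"]] by simp
  qed
  then show "of_int k \<in> ring_of_integers K"
    by (simp add: ring_of_integers_def int_imp_algebraic_int)
  show add: "x \<in> ring_of_integers K \<Longrightarrow> y \<in> ring_of_integers K \<Longrightarrow> x + y \<in> ring_of_integers K"
    for x y
    by (auto simp: ring_of_integers_def algebraic_int_add is_subfieldD[OF assms])
  show "x \<in> ring_of_integers K \<Longrightarrow> y \<in> ring_of_integers K \<Longrightarrow> x * y \<in> ring_of_integers K"
    by (auto simp: ring_of_integers_def algebraic_int_mult is_subfieldD[OF assms])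
  show "x \<in> ring_of_integers K \<Longrightarrow> y \<in> ring_of_integers K \<Longrightarrow> x - y \<in> ring_of_integers K"
    using add[of x "- y"] by (auto simp: ring_of_integers_def is_subfieldD[OF assms])
qed

section \<open>Pochhammer symbols and partial fractions\<close>

lemma of_rat_pochhammer:
  "(of_rat (pochhammer a k) :: 'a::field_char_0) = pochhammer (of_rat a) k"
  by (induction k) (simp_all add: pochhammer_Suc of_rat_mult of_rat_add)

text \<open>It turns the product formula for the hypergeometric coefficients into the sum that
  termwise integration produces.\<close>

lemma partial_fraction_pochhammer:
  fixes s :: "'a::field_char_0"
  assumes "pochhammer s (Suc r) \<noteq> 0"
  shows "(\<Sum>m\<le>r. (-1) ^ m * of_nat (r choose m) / (s + of_nat m)) = fact r / pochhammer s (Suc r)"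
  using assms
proof (induction r arbitrary: s)
  case 0
  then show ?case by simp
next
  case (Suc r)
  define f where "f = (\<lambda>m. (-1) ^ m / (s + of_nat m))"
  have nz: "pochhammer s (Suc r) \<noteq> 0" "s + of_nat (Suc r) \<noteq> 0"
    using Suc.prems by (simp_all add: pochhammer_Suc)
  have nz': "s \<noteq> 0" "pochhammer (s + 1) (Suc r) \<noteq> 0"
    using Suc.prems pochhammer_rec[of s "Suc r"] by (simp_all del: pochhammer_Suc)
  have "(\<Sum>m\<le>Suc r. (-1) ^ m * of_nat (Suc r choose m) / (s + of_nat m)) =
      (\<Sum>m\<le>Suc r. of_nat (Suc r choose m) * f m)"
    by (simp add: f_def mult.commute)
  also have "\<dots> = f 0 + (\<Sum>m\<le>r. of_nat (Suc r choose Suc m) * f (Suc m))"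
    by (subst sum.atMost_Suc_shift) simp
  \<comment> \<open>Pascal's rule splits the sum into the induction hypothesis at \<open>s\<close>
    and, with opposite sign, the one at \<open>s + 1\<close>.\<close>
  also have "\<dots> = (f 0 + (\<Sum>m\<le>r. of_nat (r choose Suc m) * f (Suc m))) +
      (\<Sum>m\<le>r. of_nat (r choose m) * f (Suc m))"
    by (simp add: sum.distrib ring_distribs)
  also have "f 0 + (\<Sum>m\<le>r. of_nat (r choose Suc m) * f (Suc m)) =
      (\<Sum>m\<le>Suc r. of_nat (r choose m) * f m)"
    by (subst sum.atMost_Suc_shift) simp
  also have "\<dots> = (\<Sum>m\<le>r. (-1) ^ m * of_nat (r choose m) / (s + of_nat m))"
    by (simp add: f_def mult.commute)
  also have "\<dots> = fact r / pochhammer s (Suc r)"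
    by (rule Suc.IH[OF nz(1)])
  also have "(\<Sum>m\<le>r. of_nat (r choose m) * f (Suc m)) =
      - (\<Sum>m\<le>r. (-1) ^ m * of_nat (r choose m) / (s + 1 + of_nat m))"
    unfolding sum_negf[symmetric] by (intro sum.cong) (simp_all add: f_def algebra_simps)
  also have "\<dots> = - (fact r / pochhammer (s + 1) (Suc r))"
    by (simp only: Suc.IH[OF nz'(2)])
  also have "fact r / pochhammer s (Suc r) = fact r * (s + of_nat (Suc r)) / pochhammer s (Suc (Suc r))"
    using nz by (simp add: pochhammer_Suc)
  also have "fact r / pochhammer (s + 1) (Suc r) = fact r * s / pochhammer s (Suc (Suc r))"
    using nz' by (subst pochhammer_rec) (simp add: field_simps)
  also have "fact r * (s + of_nat (Suc r)) / pochhammer s (Suc (Suc r)) + - (fact r * s / pochhammer s (Suc (Suc r)))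
      = fact (Suc r) / pochhammer s (Suc (Suc r))"
    by (simp add: diff_divide_distrib[symmetric] algebra_simps)
  finally show ?case .
qed

lemma pochhammer_nonint_neq_0:
  fixes \<nu> :: real
  assumes "0 < \<nu>" "\<nu> < 1"
  shows "pochhammer (\<nu> - of_nat k) m \<noteq> 0"
proof
  assume "pochhammer (\<nu> - of_nat k) m = 0"
  then obtain j where "\<nu> - of_nat k = - of_nat j" unfolding pochhammer_eq_0_iff by blast
  then have "\<nu> = of_int (int k - int j)" by simp
  then show False using assms by (metis of_int_0_less_iff of_int_less_1_iff zless_imp_add1_zle add_0 leD)
qed

section \<open>The Pade approximants and their primitive\<close>

text \<open>For \<open>\<nu> = 1/n\<close> these are the coefficients of the hypergeometric
  polynomial (\<open>coeff_hyp_X\<close>), arranged so that the denominator is that of the partial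
  fraction identity at \<open>s = \<nu> - k\<close>.\<close>

definition pade_coeff :: "real \<Rightarrow> nat \<Rightarrow> nat \<Rightarrow> real" where
  "pade_coeff \<nu> r k = (-1) ^ k * of_nat (r choose k) *
     pochhammer \<nu> (Suc r) / pochhammer (\<nu> - of_nat k) (Suc r)"

lemma coeff_hyp_X:
  assumes "n \<ge> 2"
  shows "of_rat (coeff (hyp_X n r) k) = pade_coeff (1 / real n) r k"
proof (cases "k \<le> r")
  case False
  then show ?thesis by (simp add: hyp_X_def coeff_truncate_fps pade_coeff_def)
next
  case True
  define \<nu> where "\<nu> = 1 / real n"
  have \<nu>: "0 < \<nu>" "\<nu> < 1" using assms by (simp_all add: \<nu>_def)
  have [simp]: "(of_rat (1 / of_nat n) :: real) = \<nu>" by (simp add: \<nu>_def of_rat_divide)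
  have [simp]: "(of_rat (fact k) :: real) = fact k" by (metis of_nat_fact of_rat_of_nat_eq)
  have "of_rat (coeff (hyp_X n r) k) =
      pochhammer (- of_nat r) k * pochhammer (- of_nat r - \<nu>) k / (pochhammer (1 - \<nu>) k * fact k)"
    using True
    by (simp add: hyp_X_def coeff_truncate_fps of_rat_divide of_rat_mult of_rat_pochhammer
        of_rat_minus of_rat_diff \<nu>_def)
  also have "pochhammer (- of_nat r :: real) k = (-1) ^ k * (of_nat (r choose k) * fact k)"
    using True by (simp add: binomial_gbinomial gbinomial_pochhammer)
  also have "pochhammer (- of_nat r - \<nu>) k = (-1) ^ k * pochhammer (\<nu> - of_nat k + of_nat (Suc r)) k"
    using pochhammer_minus[of "of_nat r + \<nu>" k]
    by (simp add: algebra_simps minus_diff_commute)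
  also have "pochhammer (1 - \<nu>) k = (-1) ^ k * pochhammer (\<nu> - of_nat k) k"
    using pochhammer_minus[of "\<nu> - 1" k] by (simp add: algebra_simps)
  also have "(-1) ^ k * (of_nat (r choose k) * fact k) *
      ((-1) ^ k * pochhammer (\<nu> - of_nat k + of_nat (Suc r)) k) /
      ((-1) ^ k * pochhammer (\<nu> - of_nat k) k * fact k) =
      (-1) ^ k * of_nat (r choose k) * (pochhammer (\<nu> - of_nat k + of_nat (Suc r)) k /
      pochhammer (\<nu> - of_nat k) k)" by simp
  \<comment> \<open>The Pochhammer symbol of length \<open>k + Suc r\<close> at
    \<open>\<nu> - k\<close> is split in two orders.\<close>
  also have "pochhammer (\<nu> - of_nat k + of_nat (Suc r)) k / pochhammer (\<nu> - of_nat k) k =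
     pochhammer \<nu> (Suc r) / pochhammer (\<nu> - of_nat k) (Suc r)"
    using pochhammer_product'[of "\<nu> - of_nat k" k "Suc r"]
      pochhammer_product'[of "\<nu> - of_nat k" "Suc r" k]
      pochhammer_nonint_neq_0[OF \<nu>, of k]
    by (simp add: frac_eq_eq add.commute[of k] mult.commute)
  finally show ?thesis by (simp add: pade_coeff_def \<nu>_def)
qed

definition pade_poly :: "real \<Rightarrow> nat \<Rightarrow> complex \<Rightarrow> complex" where
  "pade_poly \<nu> r x = (\<Sum>k\<le>r. of_real (pade_coeff \<nu> r k) * x ^ k)"

text \<open>The variables are logarithms: with \<open>T = exp s\<close> and \<open>x = exp L\<close>, this is the termwise
  primitive of \<open>((1 - x / T) * (1 - T)) ^ r * T powr \<nu>\<close> without constant of integration; it exists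
  because no exponent \<open>\<nu> + m - k\<close> vanishes.\<close>

definition pade_prim :: "real \<Rightarrow> nat \<Rightarrow> complex \<Rightarrow> complex \<Rightarrow> complex" where
  "pade_prim \<nu> r L s = (\<Sum>k\<le>r. \<Sum>m\<le>r. of_nat (r choose k) * of_nat (r choose m) * (-1) ^ (k + m) *
     exp (of_nat k * L + of_real (\<nu> + real m - real k) * s) / of_real (\<nu> + real m - real k))"

text \<open>The constant between approximants and primitive. For \<open>\<nu> = 1/n\<close> it is
  \<open>\<nu>\<close> times the last Gamma quotient in the hypothesis on \<open>Cn\<close>
  (\<open>pade_gamma_Gamma\<close>).\<close>

definition pade_gamma :: "real \<Rightarrow> nat \<Rightarrow> real" where
  "pade_gamma \<nu> r = pochhammer \<nu> (Suc r) / fact r"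

lemma nonint_neq_0:
  fixes \<nu> :: real
  assumes "0 < \<nu>" "\<nu> < 1"
  shows "\<nu> + real m \<noteq> real k"
  using pochhammer_nonint_neq_0[OF assms, of k "Suc m"] by (auto simp: pochhammer_Suc)

lemma pade_coeff_sum:
  assumes "0 < \<nu>" "\<nu> < 1"
  shows "pade_coeff \<nu> r k = pade_gamma \<nu> r *
    (\<Sum>m\<le>r. of_nat (r choose k) * of_nat (r choose m) * (-1) ^ (k + m) / (\<nu> + real m - real k))"
proof -
  have "(\<Sum>m\<le>r. of_nat (r choose k) * of_nat (r choose m) * (-1) ^ (k + m) / (\<nu> + real m - real k)) =
    (-1) ^ k * of_nat (r choose k) *
      (\<Sum>m\<le>r. (-1) ^ m * of_nat (r choose m) / ((\<nu> - real k) + real m))"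
    unfolding sum_distrib_left by (intro sum.cong) (simp_all add: power_add algebra_simps)
  also have "\<dots> = (-1) ^ k * of_nat (r choose k) * (fact r / pochhammer (\<nu> - real k) (Suc r))"
    using partial_fraction_pochhammer[OF pochhammer_nonint_neq_0[OF assms, of k r for r]] by simp
  finally show ?thesis by (simp add: pade_coeff_def pade_gamma_def)
qed

lemma pade_poly_eq_prim_0:
  assumes "0 < \<nu>" "\<nu> < 1"
  shows "pade_poly \<nu> r (exp L) = of_real (pade_gamma \<nu> r) * pade_prim \<nu> r L 0"
  unfolding pade_poly_def pade_coeff_sum[OF assms] pade_prim_def sum_distrib_left sum_distrib_right of_real_sum of_real_mult
  by (intro sum.cong refl) (simp add: exp_of_nat_mult[symmetric])

lemma sum_atMost_rev: "(\<Sum>k\<le>(r::nat). f (r - k)) = (\<Sum>k\<le>r. f k)"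
  by (rule sum.reindex_bij_witness[of _ "\<lambda>k. r - k" "\<lambda>k. r - k"]) auto

text \<open>At \<open>s = L\<close> the exponent is \<open>(\<nu> + m) * L\<close>, free of
  \<open>k\<close>. Reversing both indices, \<open>k\<close> to \<open>r - k\<close> and
  \<open>m\<close> to \<open>r - m\<close>, and exchanging their roles matches this with the left
  side.\<close>

lemma pade_poly_eq_prim_L:
  assumes "0 < \<nu>" "\<nu> < 1"
  shows "exp (of_real \<nu> * L) * exp L ^ r * pade_poly \<nu> r (exp (- L)) =
    of_real (pade_gamma \<nu> r) * pade_prim \<nu> r L L"
proof -
  define g where "g = (\<lambda>k m. complex_of_nat (r choose k) * of_nat (r choose m) * (-1) ^ (k + m))"
  have sym: "g (r - k) (r - m) = g k m" if "k \<le> r" "m \<le> r" for k m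
  proof -
    have "(-1::complex) ^ (r - k + (r - m)) = (-1) ^ (k + m)"
      using that by (auto simp: minus_one_power_iff)
    moreover have "r choose (r - k) = r choose k" "r choose (r - m) = r choose m"
      using that by (simp_all add: binomial_symmetric[symmetric])
    ultimately show ?thesis by (simp only: g_def)
  qed
  have pw: "exp (of_real \<nu> * L) * exp L ^ r * exp (- L) ^ k = exp (of_real \<nu> * L + of_nat (r - k) * L)"
    if "k \<le> r" for k
  proof -
    have "exp L ^ r * exp (- L) ^ k = exp L ^ (r - k)"
      using that power_add[of "exp L" "r - k" k] by (simp add: exp_minus power_inverse)
    then show ?thesis by (simp add: exp_add exp_of_nat_mult)
  qed
  have "exp (of_real \<nu> * L) * exp L ^ r * pade_poly \<nu> r (exp (- L)) =
     (\<Sum>k\<le>r. \<Sum>m\<le>r. of_real (pade_gamma \<nu> r) * (g k m * exp (of_real \<nu> * L + of_nat (r - k) * L) / of_real (\<nu> + real m - real k)))"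
  proof -
    have "exp (of_real \<nu> * L) * exp L ^ r * pade_poly \<nu> r (exp (- L)) =
      (\<Sum>k\<le>r. of_real (pade_coeff \<nu> r k) * (exp (of_real \<nu> * L) * exp L ^ r * exp (- L) ^ k))"
      by (simp add: pade_poly_def sum_distrib_left mult_ac)
    also have "\<dots> = (\<Sum>k\<le>r. of_real (pade_coeff \<nu> r k) * exp (of_real \<nu> * L + of_nat (r - k) * L))"
      by (intro sum.cong refl) (simp add: pw)
    finally show ?thesis
      by (simp add: pade_coeff_sum[OF assms] sum_distrib_left sum_distrib_right g_def mult_ac)
  qed
  also have "\<dots> = of_real (pade_gamma \<nu> r) * (\<Sum>m\<le>r. \<Sum>k\<le>r. g k m * exp (of_real \<nu> * L + of_nat (r - k) * L) / of_real (\<nu> + real m - real k))"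
    by (subst sum.swap) (simp add: sum_distrib_left)
  also have "(\<Sum>m\<le>r. \<Sum>k\<le>r. g k m * exp (of_real \<nu> * L + of_nat (r - k) * L) / of_real (\<nu> + real m - real k))
    = (\<Sum>m\<le>r. \<Sum>k\<le>r. g (r - k) (r - m) * exp (of_real \<nu> * L + of_nat (r - (r - k)) * L) / of_real (\<nu> + real (r - m) - real (r - k)))"
    by (subst sum_atMost_rev[symmetric], subst sum_atMost_rev[symmetric]) simp
  also have "\<dots> = (\<Sum>m\<le>r. \<Sum>k\<le>r. g k m * exp (of_real \<nu> * L + of_nat k * L) / of_real (\<nu> + real k - real m))"
    by (intro sum.cong refl) (simp add: sym of_nat_diff)
  also have "\<dots> = pade_prim \<nu> r L L"
    unfolding pade_prim_def
    by (intro sum.cong refl) (simp add: g_def algebra_simps)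
  finally show ?thesis .
qed

lemma alternating_binomial: "(1 - z) ^ r = (\<Sum>k\<le>r. of_nat (r choose k) * (-1) ^ k * z ^ k)" for z :: complex
  using binomial_ring[of "- z" 1 r] by (simp add: power_minus[of z] algebra_simps)

text \<open>Expanding both binomial powers gives the exponentials of \<open>pade_prim\<close> term
  by term. As \<open>dT/T = ds\<close>, the weight is \<open>T powr \<nu>\<close> in the logarithmic
  variable.\<close>

lemma pade_prim_deriv:
  assumes "0 < \<nu>" "\<nu> < 1"
  shows "(pade_prim \<nu> r L has_field_derivative
    exp (of_real \<nu> * s) * ((1 - exp (L - s)) * (1 - exp s)) ^ r) (at s within A)"
proof -
  have nz: "complex_of_real (\<nu> + real m - real k) \<noteq> 0" for m k
    using nonint_neq_0[OF assms, of m k] by (simp del: of_real_add of_real_diff)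
  have "(pade_prim \<nu> r L has_field_derivative (\<Sum>k\<le>r. \<Sum>m\<le>r. of_nat (r choose k) * of_nat (r choose m) * (-1) ^ (k + m) *
     exp (of_nat k * L + of_real (\<nu> + real m - real k) * s))) (at s within A)"
    unfolding pade_prim_def
    by (intro DERIV_sum) (auto intro!: derivative_eq_intros simp: nz nonint_neq_0[OF assms] simp del: of_real_add of_real_diff)
  also have "(\<Sum>k\<le>r. \<Sum>m\<le>r. of_nat (r choose k) * of_nat (r choose m) * (-1) ^ (k + m) *
     exp (of_nat k * L + of_real (\<nu> + real m - real k) * s)) =
    exp (of_real \<nu> * s) * ((1 - exp (L - s)) * (1 - exp s)) ^ r"
  proof -
    have ker: "exp (of_real \<nu> * s) * exp (L - s) ^ k * exp s ^ m =
        exp (of_nat k * L + of_real (\<nu> + real m - real k) * s)" for k m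
      by (simp add: exp_of_nat_mult[symmetric] exp_add[symmetric] algebra_simps)
    have "exp (of_real \<nu> * s) * ((1 - exp (L - s)) * (1 - exp s)) ^ r =
      exp (of_real \<nu> * s) * (\<Sum>k\<le>r. \<Sum>m\<le>r. (of_nat (r choose k) * (-1) ^ k * exp (L - s) ^ k) *
        (of_nat (r choose m) * (-1) ^ m * exp s ^ m))"
      by (simp only: power_mult_distrib alternating_binomial sum_product)
    also have "\<dots> = (\<Sum>k\<le>r. \<Sum>m\<le>r. of_nat (r choose k) * of_nat (r choose m) * (-1) ^ (k + m) *
      (exp (of_real \<nu> * s) * exp (L - s) ^ k * exp s ^ m))"
      by (simp only: sum_distrib_left power_add mult_ac)
    finally show ?thesis by (simp only: ker)
  qed
  finally show ?thesis .
qed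

section \<open>Bounds for the approximants and the remainder\<close>

text \<open>The mean value inequality in the logarithmic plane, where intervals of the positive real
  axis and arcs around 0 become straight segments.\<close>

lemma pade_prim_diff_bound:
  assumes \<nu>: "0 < \<nu>" "\<nu> < 1" and S: "convex S"
    and ker: "\<And>s. s \<in> S \<Longrightarrow> cmod ((1 - exp (L - s)) * (1 - exp s)) \<le> B"
    and M: "\<And>s. s \<in> S \<Longrightarrow> \<nu> * Re s \<le> M"
    and st: "s \<in> S" "t \<in> S"
  shows "cmod (pade_prim \<nu> r L s - pade_prim \<nu> r L t) \<le> exp M * B ^ r * cmod (s - t)"
proof (rule field_differentiable_bound[OF S pade_prim_deriv[OF \<nu>] _ st])
  fix s assume s: "s \<in> S"
  have "cmod (exp (of_real \<nu> * s)) = exp (\<nu> * Re s)" by simp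
  also have "\<dots> \<le> exp M" using M[OF s] by simp
  finally have "cmod (exp (of_real \<nu> * s)) \<le> exp M" .
  then show "cmod (exp (of_real \<nu> * s) * ((1 - exp (L - s)) * (1 - exp s)) ^ r) \<le> exp M * B ^ r"
    unfolding norm_mult[of "exp (of_real \<nu> * s)"] norm_power
    by (intro mult_mono power_mono ker[OF s]) auto
qed

text \<open>On real segments and on circles around 0 both brackets on the right are real, twice a cosine or twice a hyperbolic
  cosine, so that bounding the kernel amounts to comparing real numbers.\<close>

lemma kernel_factor:
  fixes L s :: complex
  shows "(1 - exp (L - s)) * (1 - exp s) =
    exp (L / 2) * ((exp (L / 2) + exp (- (L / 2))) - (exp (s - L / 2) + exp (- (s - L / 2))))"
proof -
  have "exp (L / 2) * exp (L / 2) = exp L" "exp (L / 2) * exp (- (L / 2)) = 1"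
    "exp (L / 2) * exp (s - L / 2) = exp s" "exp (L / 2) * exp (- (s - L / 2)) = exp (L - s)"
    "exp (L - s) * exp s = exp L"
    by (simp_all add: exp_add[symmetric] algebra_simps)
  then show ?thesis by (simp add: algebra_simps)
qed

text \<open>These are the values of the kernel at its critical points \<open>s = L/2\<close> and
  \<open>s = L/2 + pi * i\<close>, in the form given by \<open>kernel_factor\<close>.\<close>

lemma
  fixes L :: complex
  shows one_minus_exp_half_sq: "(1 - exp (L / 2))\<^sup>2 = exp (L / 2) * ((exp (L / 2) + exp (- (L / 2))) - 2)"
    and one_plus_exp_half_sq: "(1 + exp (L / 2))\<^sup>2 = exp (L / 2) * ((exp (L / 2) + exp (- (L / 2))) + 2)"
proof -
  have "exp (L / 2) * exp (- (L / 2)) = 1" by (simp add: exp_add[symmetric])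
  then show "(1 - exp (L / 2))\<^sup>2 = exp (L / 2) * ((exp (L / 2) + exp (- (L / 2))) - 2)"
    "(1 + exp (L / 2))\<^sup>2 = exp (L / 2) * ((exp (L / 2) + exp (- (L / 2))) + 2)"
    by (simp_all add: power2_eq_square algebra_simps)
qed

lemma kernel_le_minus:
  assumes "exp (L / 2) + exp (- (L / 2)) = of_real C"
    and "exp (s - L / 2) + exp (- (s - L / 2)) = of_real k" and "\<bar>C - k\<bar> \<le> \<bar>C - 2\<bar>"
  shows "cmod ((1 - exp (L - s)) * (1 - exp s)) \<le> (cmod (1 - exp (L / 2)))\<^sup>2"
proof -
  have "cmod (of_real C - of_real k) \<le> cmod (of_real C - 2)"
    using assms(3) norm_of_real[of "C - k", where ?'a = complex] norm_of_real[of "C - 2", where ?'a = complex]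
    by simp
  then show ?thesis
    unfolding kernel_factor norm_power[symmetric] one_minus_exp_half_sq assms(1,2) norm_mult
    by (intro mult_left_mono) auto
qed

lemma kernel_le_plus:
  assumes "exp (L / 2) + exp (- (L / 2)) = of_real C"
    and "exp (s - L / 2) + exp (- (s - L / 2)) = of_real k" and "C \<ge> 0" "\<bar>k\<bar> \<le> 2"
  shows "cmod ((1 - exp (L - s)) * (1 - exp s)) \<le> (cmod (1 + exp (L / 2)))\<^sup>2"
proof -
  have "cmod (of_real C - of_real k) \<le> cmod (of_real C + 2)"
    using assms(3,4) norm_of_real[of "C - k", where ?'a = complex] norm_of_real[of "C + 2", where ?'a = complex]
    by simp
  then show ?thesis
    unfolding kernel_factor norm_power[symmetric] one_plus_exp_half_sq assms(1,2) norm_mult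
    by (intro mult_left_mono) auto
qed

lemma exp_i_sum: "exp (\<i> * of_real t) + exp (- (\<i> * of_real t)) = of_real (2 * cos t)"
  by (simp add: complex_eq_iff Re_exp Im_exp)

lemma exp_real_sum: "exp (of_real t) + exp (- of_real t) = complex_of_real (2 * cosh t)"
  by (simp add: complex_eq_iff Re_exp Im_exp cosh_field_def)

text \<open>Measured from the midpoint of the arc, the angle is at most
  \<open>\<bar>\<phi>\<bar> / 2\<close>, so its cosine lies between \<open>cos (\<phi> / 2)\<close>
  and 1. The kernel is largest at the midpoint.\<close>

lemma kernel_circle_minus:
  assumes "\<bar>\<phi>\<bar> \<le> pi" "0 \<le> u" "u \<le> 1"
  shows "cmod ((1 - exp (\<i> * of_real \<phi> - \<i> * of_real (u * \<phi>))) * (1 - exp (\<i> * of_real (u * \<phi>))))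
    \<le> (cmod (1 - exp (\<i> * of_real \<phi> / 2)))\<^sup>2"
proof (rule kernel_le_minus)
  show "exp (\<i> * of_real \<phi> / 2) + exp (- (\<i> * of_real \<phi> / 2)) = of_real (2 * cos (\<phi> / 2))"
    using exp_i_sum[of "\<phi> / 2"] by simp
  show "exp (\<i> * of_real (u * \<phi>) - \<i> * of_real \<phi> / 2) +
      exp (- (\<i> * of_real (u * \<phi>) - \<i> * of_real \<phi> / 2)) = of_real (2 * cos (u * \<phi> - \<phi> / 2))"
    using exp_i_sum[of "u * \<phi> - \<phi> / 2"] by (simp add: algebra_simps)
  have "\<bar>u * \<phi> - \<phi> / 2\<bar> = \<bar>u - 1 / 2\<bar> * \<bar>\<phi>\<bar>"
    by (simp add: abs_mult[symmetric] algebra_simps)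
  also have "\<dots> \<le> 1 / 2 * \<bar>\<phi>\<bar>"
    using assms by (intro mult_right_mono) (auto simp: abs_if)
  finally have "\<bar>u * \<phi> - \<phi> / 2\<bar> \<le> \<bar>\<phi> / 2\<bar>" by simp
  then have "cos \<bar>\<phi> / 2\<bar> \<le> cos \<bar>u * \<phi> - \<phi> / 2\<bar>"
    using assms by (intro cos_monotone_0_pi_le) auto
  then show "\<bar>2 * cos (\<phi> / 2) - 2 * cos (u * \<phi> - \<phi> / 2)\<bar> \<le> \<bar>2 * cos (\<phi> / 2) - 2\<bar>"
    using cos_le_one[of "u * \<phi> - \<phi> / 2"] unfolding cos_abs_real by linarith
qed

text \<open>The same comparison with \<open>cosh\<close>, which lies between 1 and
  \<open>cosh (l / 2)\<close>.\<close>

lemma kernel_real_minus: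
  assumes "0 \<le> u" "u \<le> 1"
  shows "cmod ((1 - exp (of_real l - of_real (u * l))) * (1 - exp (of_real (u * l))))
    \<le> (cmod (1 - exp (of_real l / 2)))\<^sup>2"
proof (rule kernel_le_minus)
  show "exp (of_real l / 2) + exp (- (of_real l / 2)) = complex_of_real (2 * cosh (l / 2))"
    using exp_real_sum[of "l / 2"] by simp
  show "exp (of_real (u * l) - of_real l / 2) +
      exp (- (of_real (u * l) - of_real l / 2)) = complex_of_real (2 * cosh (u * l - l / 2))"
    using exp_real_sum[of "u * l - l / 2"] by simp
  have "\<bar>u * l - l / 2\<bar> = \<bar>u - 1 / 2\<bar> * \<bar>l\<bar>"
    by (simp add: abs_mult[symmetric] algebra_simps)
  also have "\<dots> \<le> 1 / 2 * \<bar>l\<bar>"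
    using assms by (intro mult_right_mono) (auto simp: abs_if)
  finally have "\<bar>u * l - l / 2\<bar> \<le> \<bar>l / 2\<bar>" by simp
  then have "cosh \<bar>u * l - l / 2\<bar> \<le> cosh \<bar>l / 2\<bar>"
    by (subst cosh_real_nonneg_le_iff) auto
  then show "\<bar>2 * cosh (l / 2) - 2 * cosh (u * l - l / 2)\<bar> \<le> \<bar>2 * cosh (l / 2) - 2\<bar>"
    using cosh_real_ge_1[of "u * l - l / 2"] unfolding cosh_real_abs by linarith
qed

text \<open>The range of \<open>\<phi>\<close> makes \<open>cos (\<phi> / 2)\<close> nonnegative.
  The bound holds for every \<open>\<theta>\<close>, as the loop argument requires.\<close>

lemma kernel_circle_plus:
  assumes "\<bar>\<phi>\<bar> \<le> pi"
  shows "cmod ((1 - exp (\<i> * of_real \<phi> - \<i> * of_real \<theta>)) * (1 - exp (\<i> * of_real \<theta>)))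
    \<le> (cmod (1 + exp (\<i> * of_real \<phi> / 2)))\<^sup>2"
proof (rule kernel_le_plus)
  show "exp (\<i> * of_real \<phi> / 2) + exp (- (\<i> * of_real \<phi> / 2)) = of_real (2 * cos (\<phi> / 2))"
    using exp_i_sum[of "\<phi> / 2"] by simp
  show "exp (\<i> * of_real \<theta> - \<i> * of_real \<phi> / 2) +
      exp (- (\<i> * of_real \<theta> - \<i> * of_real \<phi> / 2)) = of_real (2 * cos (\<theta> - \<phi> / 2))"
    using exp_i_sum[of "\<theta> - \<phi> / 2"] by (simp add: algebra_simps)
  show "0 \<le> 2 * cos (\<phi> / 2)" using assms by (simp add: cos_ge_zero)
qed (simp add: abs_mult)

text \<open>On the circle of radius \<open>exp (l / 2)\<close> the difference
  \<open>s - L / 2\<close> is purely imaginary, so the second bracket is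
  \<open>2 * cos \<theta>\<close>.\<close>

lemma kernel_real_plus:
  "cmod ((1 - exp (of_real l - (of_real l / 2 + \<i> * of_real \<theta>))) * (1 - exp (of_real l / 2 + \<i> * of_real \<theta>)))
    \<le> (cmod (1 + exp (of_real l / 2)))\<^sup>2"
proof (rule kernel_le_plus)
  show "exp (of_real l / 2) + exp (- (of_real l / 2)) = complex_of_real (2 * cosh (l / 2))"
    using exp_real_sum[of "l / 2"] by simp
  show "exp (of_real l / 2 + \<i> * of_real \<theta> - of_real l / 2) +
      exp (- (of_real l / 2 + \<i> * of_real \<theta> - of_real l / 2)) = of_real (2 * cos \<theta>)"
    using exp_i_sum[of \<theta>] by simp
qed (simp_all add: abs_mult)

lemma remainder_circle_bound:
  assumes "0 < \<nu>" "\<nu> < 1" "\<bar>\<phi>\<bar> \<le> pi"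
  shows "cmod (pade_prim \<nu> r (\<i> * of_real \<phi>) (\<i> * of_real \<phi>) - pade_prim \<nu> r (\<i> * of_real \<phi>) 0)
    \<le> \<bar>\<phi>\<bar> * (cmod (1 - exp (\<i> * of_real \<phi> / 2)))\<^sup>2 ^ r"
proof -
  let ?S = "closed_segment 0 (\<i> * of_real \<phi>)"
  have "cmod (pade_prim \<nu> r (\<i> * of_real \<phi>) (\<i> * of_real \<phi>) - pade_prim \<nu> r (\<i> * of_real \<phi>) 0)
      \<le> exp 0 * (cmod (1 - exp (\<i> * of_real \<phi> / 2)))\<^sup>2 ^ r * cmod (\<i> * of_real \<phi> - 0)"
  proof (rule pade_prim_diff_bound[OF assms(1,2), where S = ?S])
    fix s assume "s \<in> ?S"
    then obtain u where u: "0 \<le> u" "u \<le> 1" "s = \<i> * of_real (u * \<phi>)"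
      by (auto simp: closed_segment_def scaleR_conv_of_real)
    show "cmod ((1 - exp (\<i> * of_real \<phi> - s)) * (1 - exp s)) \<le> (cmod (1 - exp (\<i> * of_real \<phi> / 2)))\<^sup>2"
      unfolding u(3) by (rule kernel_circle_minus[OF assms(3) u(1,2)])
    show "\<nu> * Re s \<le> 0" by (simp add: u(3))
  qed auto
  then show ?thesis by (simp add: norm_mult mult.commute)
qed

lemma remainder_real_bound:
  assumes "0 < \<nu>" "\<nu> < 1" "0 \<le> l"
  shows "cmod (pade_prim \<nu> r (of_real l) (of_real l) - pade_prim \<nu> r (of_real l) 0)
    \<le> exp (\<nu> * l) * l * (cmod (1 - exp (of_real l / 2)))\<^sup>2 ^ r"
proof -
  let ?S = "closed_segment 0 (complex_of_real l)"
  have "cmod (pade_prim \<nu> r (of_real l) (of_real l) - pade_prim \<nu> r (of_real l) 0)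
      \<le> exp (\<nu> * l) * (cmod (1 - exp (of_real l / 2)))\<^sup>2 ^ r * cmod (complex_of_real l - 0)"
  proof (rule pade_prim_diff_bound[OF assms(1,2), where S = ?S])
    fix s assume "s \<in> ?S"
    then obtain u where u: "0 \<le> u" "u \<le> 1" "s = of_real (u * l)"
      by (auto simp: closed_segment_def scaleR_conv_of_real)
    show "cmod ((1 - exp (of_real l - s)) * (1 - exp s)) \<le> (cmod (1 - exp (of_real l / 2)))\<^sup>2"
      unfolding u(3) by (rule kernel_real_minus[OF u(1,2)])
    show "\<nu> * Re s \<le> \<nu> * l" using u assms by (simp add: mult_left_le_one_le)
  qed auto
  then show ?thesis using assms by (simp add: mult_ac)
qed

text \<open>The exponents \<open>\<nu> + m - k\<close> differ from \<open>\<nu>\<close> by integers,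
  so every term gains the same factor along a full turn.\<close>

lemma pade_prim_shift:
  "pade_prim \<nu> r L (s + 2 * of_real pi * \<i>) = exp (2 * of_real pi * \<i> * of_real \<nu>) * pade_prim \<nu> r L s"
proof -
  have *: "exp (of_nat k * L + of_real (\<nu> + real m - real k) * (s + 2 * of_real pi * \<i>)) =
      exp (2 * of_real pi * \<i> * of_real \<nu>) * exp (of_nat k * L + of_real (\<nu> + real m - real k) * s)" for k m
  proof -
    have "exp (of_nat k * L + of_real (\<nu> + real m - real k) * (s + 2 * of_real pi * \<i>)) =
      exp (2 * of_real pi * \<i> * of_real \<nu> + (of_nat k * L + of_real (\<nu> + real m - real k) * s) +
        \<i> * (of_int (int m - int k) * (of_real pi * 2)))"
      by (rule arg_cong[of _ _ exp]) (simp add: algebra_simps)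
    also have "\<dots> = exp (2 * of_real pi * \<i> * of_real \<nu> + (of_nat k * L + of_real (\<nu> + real m - real k) * s))"
      by (rule exp_plus_2pin)
    finally show ?thesis by (simp only: exp_add)
  qed
  show ?thesis unfolding pade_prim_def * by (simp add: sum_distrib_left mult_ac)
qed

text \<open>The difference \<open>sin y - y / 2\<close> increases as long as
  \<open>cos y \<ge> 1 / 2\<close>. With \<open>\<nu> \<le> 1 / 3\<close> the range covers
  \<open>y = pi * \<nu>\<close>.\<close>

lemma sin_ge_half:
  assumes "0 \<le> y" "y \<le> pi / 3"
  shows "y / 2 \<le> sin y"
proof -
  have "sin 0 - 0 / 2 \<le> sin y - y / 2"
  proof (rule DERIV_nonneg_imp_nondecreasing[OF assms(1)])
    fix x assume x: "0 \<le> x" "x \<le> y"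
    have "cos (pi / 3) \<le> cos x" using x assms by (intro cos_monotone_0_pi_le) auto
    then have "0 \<le> cos x - 1 / 2" by (simp add: cos_60)
    then show "\<exists>z. ((\<lambda>x. sin x - x / 2) has_real_derivative z) (at x) \<and> 0 \<le> z"
      by (intro exI[of _ "cos x - 1 / 2"]) (auto intro!: derivative_eq_intros)
  qed
  then show ?thesis by simp
qed

text \<open>Going once around the circle through \<open>exp s\<close> multiplies the primitive by
  \<open>exp (2 * pi * \<i> * \<nu>) \<noteq> 1\<close>, so its increment determines its value.\<close>

lemma pade_prim_loop_bound:
  assumes \<nu>: "0 < \<nu>" "\<nu> \<le> 1 / 3"
    and ker: "\<And>\<theta>. cmod ((1 - exp (L - (s + \<i> * of_real \<theta>))) * (1 - exp (s + \<i> * of_real \<theta>))) \<le> B"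
    and s: "Re s \<le> 0"
  shows "\<nu> * cmod (pade_prim \<nu> r L s) \<le> 2 * B ^ r"
proof -
  have \<nu>1: "\<nu> < 1" using \<nu> by simp
  have B: "B \<ge> 0" using ker[of 0] norm_ge_zero order_trans by blast
  let ?S = "closed_segment s (s + 2 * of_real pi * \<i>)"
  have *: "cmod (pade_prim \<nu> r L (s + 2 * of_real pi * \<i>) - pade_prim \<nu> r L s)
      \<le> exp 0 * B ^ r * cmod (s + 2 * of_real pi * \<i> - s)"
  proof (rule pade_prim_diff_bound[OF \<nu>(1) \<nu>1, where S = ?S])
    fix z assume "z \<in> ?S"
    then obtain u where u: "z = s + \<i> * of_real (u * (2 * pi))"
      by (auto simp: closed_segment_def scaleR_conv_of_real algebra_simps)
    show "cmod ((1 - exp (L - z)) * (1 - exp z)) \<le> B"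
      unfolding u by (rule ker)
    show "\<nu> * Re z \<le> 0" using s \<nu> by (simp add: u mult_nonneg_nonpos)
  qed auto
  have 1: "cmod (exp (2 * of_real pi * \<i> * of_real \<nu>) - 1) * cmod (pade_prim \<nu> r L s) \<le> 2 * pi * B ^ r"
  proof -
    have "pade_prim \<nu> r L (s + 2 * of_real pi * \<i>) - pade_prim \<nu> r L s =
      (exp (2 * of_real pi * \<i> * of_real \<nu>) - 1) * pade_prim \<nu> r L s"
      by (simp only: pade_prim_shift left_diff_distrib mult_1)
    then show ?thesis using * by (simp add: norm_mult mult_ac)
  qed
  \<comment> \<open>The half-angle factor leaves the modulus \<open>2 * sin (pi * \<nu>)\<close>, at
    least \<open>pi * \<nu>\<close>; this \<open>pi\<close> cancels that of the loop length
    \<open>2 * pi\<close>.\<close>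
  have "exp (2 * of_real pi * \<i> * of_real \<nu>) - 1 = exp (\<i> * of_real (pi * \<nu>)) * (2 * \<i> * of_real (sin (pi * \<nu>)))"
  proof -
    have "exp (2 * of_real pi * \<i> * of_real \<nu>) = cis (pi * \<nu>) * cis (pi * \<nu>)"
      by (simp add: cis_conv_exp exp_add[symmetric] algebra_simps)
    moreover have "cis (pi * \<nu>) * cis (pi * \<nu>) - 1 = cis (pi * \<nu>) * (2 * \<i> * of_real (sin (pi * \<nu>)))"
      using sin_cos_squared_add[of "pi * \<nu>"]
      by (auto simp: complex_eq_iff power2_eq_square algebra_simps)
    ultimately show ?thesis by (simp add: cis_conv_exp)
  qed
  then have "cmod (exp (2 * of_real pi * \<i> * of_real \<nu>) - 1) = 2 * \<bar>sin (pi * \<nu>)\<bar>"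
    by (simp add: norm_mult)
  moreover have "sin (pi * \<nu>) \<ge> pi * \<nu> / 2" using \<nu> by (intro sin_ge_half) auto
  ultimately have "pi * \<nu> \<le> cmod (exp (2 * of_real pi * \<i> * of_real \<nu>) - 1)" by linarith
  then have "pi * \<nu> * cmod (pade_prim \<nu> r L s) \<le> 2 * pi * B ^ r"
    using 1 by (meson mult_right_mono norm_ge_zero order_trans)
  then show ?thesis by simp
qed

lemma prim_0_circle_bound:
  assumes "0 < \<nu>" "\<nu> \<le> 1 / 3" "\<bar>\<phi>\<bar> \<le> pi"
  shows "\<nu> * cmod (pade_prim \<nu> r (\<i> * of_real \<phi>) 0) \<le> 2 * (cmod (1 + exp (\<i> * of_real \<phi> / 2)))\<^sup>2 ^ r"
  using kernel_circle_plus[OF assms(3)] by (intro pade_prim_loop_bound assms) auto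

text \<open>The circle of radius \<open>exp (l / 2)\<close> need not pass through 1. The loop
  estimate is applied at \<open>s = l / 2\<close>; the real segment from there to 0, where the
  kernel has an even smaller bound, contributes \<open>- \<nu> * l / 2\<close>.\<close>

lemma prim_0_real_bound:
  assumes \<nu>: "0 < \<nu>" "\<nu> \<le> 1 / 3" and l: "l \<le> 0"
  shows "\<nu> * cmod (pade_prim \<nu> r (of_real l) 0) \<le> (2 - \<nu> * l / 2) * (cmod (1 + exp (of_real l / 2)))\<^sup>2 ^ r"
proof -
  define B where "B = (cmod (1 + exp (of_real l / 2)))\<^sup>2"
  have 1: "\<nu> * cmod (pade_prim \<nu> r (of_real l) (of_real l / 2)) \<le> 2 * B ^ r"
    unfolding B_def using kernel_real_plus l by (intro pade_prim_loop_bound \<nu>) auto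
  have "(cmod (1 - exp (of_real l / 2)))\<^sup>2 \<le> B"
  proof -
    have "cmod (1 - exp (of_real l / 2)) = \<bar>1 - exp (l / 2)\<bar>"
      "cmod (1 + exp (of_real l / 2)) = \<bar>1 + exp (l / 2)\<bar>"
      using norm_of_real[of "1 - exp (l / 2)", where ?'a = complex]
        norm_of_real[of "1 + exp (l / 2)", where ?'a = complex]
      by (simp_all add: exp_of_real[symmetric])
    moreover have "\<bar>1 - exp (l / 2)\<bar> \<le> \<bar>1 + exp (l / 2)\<bar>"
      using exp_gt_zero[of "l / 2"] by linarith
    ultimately show ?thesis unfolding B_def by (intro power_mono) auto
  qed
  note minus_le = this
  let ?S = "closed_segment 0 (complex_of_real l / 2)"
  have "cmod (pade_prim \<nu> r (of_real l) 0 - pade_prim \<nu> r (of_real l) (of_real l / 2))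
      \<le> exp 0 * B ^ r * cmod (0 - complex_of_real l / 2)"
  proof (rule pade_prim_diff_bound[where S = ?S])
    fix s assume "s \<in> ?S"
    then obtain u where u: "0 \<le> u" "u \<le> 1" "s = of_real (u / 2 * l)"
      by (auto simp: closed_segment_def scaleR_conv_of_real)
    show "cmod ((1 - exp (of_real l - s)) * (1 - exp s)) \<le> B"
      unfolding u(3) by (rule order_trans[OF kernel_real_minus minus_le]) (use u in auto)
    show "\<nu> * Re s \<le> 0" unfolding u(3) using u(1) l \<nu> by (simp add: mult_nonneg_nonpos)
  qed (use \<nu> in auto)
  then have 2: "cmod (pade_prim \<nu> r (of_real l) 0 - pade_prim \<nu> r (of_real l) (of_real l / 2)) \<le> B ^ r * (- l / 2)"
    using l by (simp add: norm_divide)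
  have "cmod (pade_prim \<nu> r (of_real l) 0) \<le> cmod (pade_prim \<nu> r (of_real l) (of_real l / 2)) + B ^ r * (- l / 2)"
    using 2 norm_triangle_sub[of "pade_prim \<nu> r (of_real l) 0" "pade_prim \<nu> r (of_real l) (of_real l / 2)"] by linarith
  then have "\<nu> * cmod (pade_prim \<nu> r (of_real l) 0) \<le>
      \<nu> * cmod (pade_prim \<nu> r (of_real l) (of_real l / 2)) + \<nu> * (B ^ r * (- l / 2))"
    using \<nu> by (metis distrib_left less_imp_le mult_left_mono)
  also have "\<dots> \<le> 2 * B ^ r + \<nu> * (B ^ r * (- l / 2))" using 1 by simp
  finally show ?thesis unfolding B_def[symmetric] by (simp add: algebra_simps)
qed

section \<open>Consecutive approximants are independent\<close>

text \<open>By induction \<open>P\<close> is \<open>(x - 1)^N\<close> times some \<open>G\<close>.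
  Cancelling the power shows that \<open>G\<close> tends to 0 at 1 from the right, so one more
  factor splits off.\<close>

lemma power_dvd_if_small_near_1:
  fixes P :: "complex poly"
  assumes "\<And>x. 1 < x \<Longrightarrow> x < 2 \<Longrightarrow> cmod (poly P (of_real x)) \<le> B * (x - 1) ^ N"
  shows "[:-1, 1:] ^ N dvd P"
  using assms
proof (induction N)
  case 0
  then show ?case by simp
next
  case (Suc N)
  have B: "B \<ge> 0"
  proof -
    define c :: real where "c = (3/2 - 1) ^ Suc N"
    have "c > 0" unfolding c_def by (intro zero_less_power) simp
    moreover have "0 \<le> B * c"
      unfolding c_def by (rule order_trans[OF norm_ge_zero Suc.prems]) auto
    ultimately show ?thesis by (simp add: zero_le_mult_iff)
  qed
  have "[:-1, 1:] ^ N dvd P"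
  proof (rule Suc.IH)
    fix x :: real assume x: "1 < x" "x < 2"
    have "B * (x - 1) ^ Suc N \<le> B * (x - 1) ^ N"
      using x B by (intro mult_left_mono power_decreasing) auto
    then show "cmod (poly P (of_real x)) \<le> B * (x - 1) ^ N" using Suc.prems[OF x] by linarith
  qed
  then obtain G where G: "P = [:-1, 1:] ^ N * G" by (elim dvdE)
  have Gb: "cmod (poly G (of_real x)) \<le> B * (x - 1)" if x: "1 < x" "x < 2" for x
  proof -
    have "poly [:-1, 1:] (complex_of_real x) = of_real (x - 1)" by simp
    then have "poly P (of_real x) = of_real ((x - 1) ^ N) * poly G (of_real x)"
      unfolding G poly_mult poly_power by (simp only: of_real_power)
    then have "cmod (poly P (of_real x)) = (x - 1) ^ N * cmod (poly G (of_real x))"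
      using x by (simp add: norm_mult norm_power del: of_real_power of_real_diff)
    then have "(x - 1) ^ N * cmod (poly G (of_real x)) \<le> (x - 1) ^ N * (B * (x - 1))"
      using Suc.prems[OF x] by (simp add: mult_ac)
    then show ?thesis using x by simp
  qed
  have "((\<lambda>x. poly G (complex_of_real x)) \<longlongrightarrow> poly G (of_real 1)) (at_right 1)"
    by (intro tendsto_intros)
  moreover have "((\<lambda>x. poly G (complex_of_real x)) \<longlongrightarrow> 0) (at_right 1)"
  proof (rule Lim_null_comparison)
    show "\<forall>\<^sub>F x in at_right 1. cmod (poly G (of_real x)) \<le> B * (x - 1)"
      using Gb by (intro eventually_at_rightI[of 1 2]) auto
    have "((\<lambda>x. B * (x - 1)) \<longlongrightarrow> B * (1 - 1)) (at_right (1::real))"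
      by (intro tendsto_intros)
    then show "((\<lambda>x. B * (x - 1)) \<longlongrightarrow> 0) (at_right (1::real))" by simp
  qed
  ultimately have "poly G 1 = 0"
    using tendsto_unique[of "at_right (1::real)"] by fastforce
  then have "[:-1, 1:] dvd G" by (simp add: poly_eq_0_iff_dvd)
  then show ?case unfolding G power_Suc2 by (rule mult_dvd_mono[OF dvd_refl])
qed

definition pade_X :: "real \<Rightarrow> nat \<Rightarrow> complex poly" where
  "pade_X \<nu> r = (\<Sum>k\<le>r. monom (of_real (pade_coeff \<nu> r k)) k)"

text \<open>The reversed polynomial \<open>x^r * X_r(1/x)\<close>, reversed at \<open>r\<close>
  whatever the degree. The approximant to \<open>x powr \<nu>\<close> is
  \<open>X_r / Y_r\<close>.\<close>

definition pade_Y :: "real \<Rightarrow> nat \<Rightarrow> complex poly" where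
  "pade_Y \<nu> r = (\<Sum>k\<le>r. monom (of_real (pade_coeff \<nu> r k)) (r - k))"

lemma poly_pade_X: "poly (pade_X \<nu> r) x = pade_poly \<nu> r x"
  by (simp add: pade_X_def pade_poly_def poly_sum poly_monom)

lemma poly_pade_Y: "x \<noteq> 0 \<Longrightarrow> poly (pade_Y \<nu> r) x = x ^ r * pade_poly \<nu> r (1 / x)"
  unfolding pade_Y_def pade_poly_def poly_sum poly_monom sum_distrib_left
  by (intro sum.cong refl) (simp add: power_diff power_divide)

lemma degree_pade_X: "degree (pade_X \<nu> r) \<le> r" and degree_pade_Y: "degree (pade_Y \<nu> r) \<le> r"
  unfolding pade_X_def pade_Y_def
  by (auto intro!: degree_sum_le order_trans[OF degree_monom_le])

lemma pade_coeff_0: "0 < \<nu> \<Longrightarrow> pade_coeff \<nu> r 0 = 1"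
  using pochhammer_pos[of \<nu> "Suc r"] by (simp add: pade_coeff_def)

lemma poly_pade_X_0: "0 < \<nu> \<Longrightarrow> poly (pade_X \<nu> r) 0 = 1"
proof -
  assume "0 < \<nu>"
  have "poly (pade_X \<nu> r) 0 = (\<Sum>k\<le>r. if k = 0 then of_real (pade_coeff \<nu> r k) else 0)"
    unfolding poly_pade_X pade_poly_def by (intro sum.cong) auto
  then show ?thesis using \<open>0 < \<nu>\<close> by (simp add: pade_coeff_0)
qed

lemma poly_pade_Y_0: "poly (pade_Y \<nu> r) 0 = of_real (pade_coeff \<nu> r r)"
proof -
  have "poly (pade_Y \<nu> r) 0 = (\<Sum>k\<le>r. if k = r then of_real (pade_coeff \<nu> r k) else 0)"
    unfolding pade_Y_def poly_sum poly_monom by (intro sum.cong) auto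
  then show ?thesis by simp
qed

text \<open>The difference of these coefficients is the value at 0 of the determinant of consecutive
  approximants. Their ratio \<open>- (\<nu> + r + 1) / (\<nu> - r - 1)\<close> is 1 only for
  \<open>\<nu> = 0\<close>.\<close>

lemma pade_coeff_top_Suc:
  assumes "0 < \<nu>" "\<nu> < 1"
  shows "pade_coeff \<nu> (Suc r) (Suc r) \<noteq> pade_coeff \<nu> r r"
proof -
  define p where "p = pochhammer \<nu> (Suc r)"
  define q where "q = pochhammer (\<nu> - real r) (Suc r)"
  have p: "p \<noteq> 0" and q: "q \<noteq> 0"
    using pochhammer_nonint_neq_0[OF assms, of 0 "Suc r"] pochhammer_nonint_neq_0[OF assms, of r "Suc r"]
    by (simp_all add: p_def q_def)
  have c0: "pade_coeff \<nu> r r = (-1) ^ r * p / q" by (simp add: pade_coeff_def p_def q_def)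
  have "pochhammer (\<nu> - real (Suc r)) (Suc (Suc r)) = (\<nu> - real (Suc r)) * q"
    unfolding q_def by (subst pochhammer_rec) (simp add: algebra_simps)
  then have "pade_coeff \<nu> (Suc r) (Suc r) = (-1) ^ Suc r * (p * (\<nu> + real (Suc r))) / ((\<nu> - real (Suc r)) * q)"
    unfolding pade_coeff_def p_def pochhammer_Suc[of \<nu> "Suc r"] by simp
  then have "pade_coeff \<nu> (Suc r) (Suc r) = pade_coeff \<nu> r r * (- ((\<nu> + real (Suc r)) / (\<nu> - real (Suc r))))"
    unfolding c0 by (simp add: mult_ac)
  moreover have "- ((\<nu> + real (Suc r)) / (\<nu> - real (Suc r))) \<noteq> 1"
    using assms by (simp add: field_simps)
  moreover have "pade_coeff \<nu> r r \<noteq> 0" using p q by (simp add: c0)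
  ultimately show ?thesis by (simp only: mult_cancel_left1 mult_cancel_left2 not_False_eq_True simp_thms)
qed

lemma pade_remainder:
  assumes "0 < \<nu>" "\<nu> < 1"
  shows "exp (of_real \<nu> * L) * poly (pade_Y \<nu> r) (exp L) - poly (pade_X \<nu> r) (exp L) =
    of_real (pade_gamma \<nu> r) * (pade_prim \<nu> r L L - pade_prim \<nu> r L 0)"
proof -
  have "exp (of_real \<nu> * L) * poly (pade_Y \<nu> r) (exp L) =
      exp (of_real \<nu> * L) * exp L ^ r * pade_poly \<nu> r (exp (- L))"
    by (simp add: poly_pade_Y exp_minus inverse_eq_divide)
  also have "\<dots> = of_real (pade_gamma \<nu> r) * pade_prim \<nu> r L L"
    by (rule pade_poly_eq_prim_L[OF assms])
  finally show ?thesis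
    by (simp add: poly_pade_X pade_poly_eq_prim_0[OF assms] right_diff_distrib)
qed

lemma pade_gamma_pos: "0 < \<nu> \<Longrightarrow> pade_gamma \<nu> r > 0"
  by (simp add: pade_gamma_def pochhammer_pos)

text \<open>The factor \<open>x powr - \<nu>\<close> absorbs \<open>exp (\<nu> * l)\<close> from
  \<open>remainder_real_bound\<close>. The length \<open>l\<close> supplies one power of
  \<open>x - 1\<close>, the kernel the other \<open>2 * r\<close>.\<close>

lemma pade_remainder_near_1:
  assumes \<nu>: "0 < \<nu>" "\<nu> < 1" and x: "1 < x"
  shows "cmod (poly (pade_Y \<nu> r) (of_real x) - of_real (x powr - \<nu>) * poly (pade_X \<nu> r) (of_real x))
    \<le> pade_gamma \<nu> r * (x - 1) ^ (2 * r + 1)"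
proof -
  define l where "l = ln x"
  have l: "l > 0" "exp l = x" using x by (simp_all add: l_def)
  have xl: "complex_of_real x = exp (of_real l)" using l(2) by (simp add: exp_of_real)
  have "complex_of_real (x powr - \<nu>) = exp (- (of_real \<nu> * of_real l))"
    using x by (simp add: powr_def l_def exp_of_real[symmetric])
  then have eq: "poly (pade_Y \<nu> r) (of_real x) - of_real (x powr - \<nu>) * poly (pade_X \<nu> r) (of_real x) =
    exp (- (of_real \<nu> * of_real l)) * (of_real (pade_gamma \<nu> r) *
      (pade_prim \<nu> r (of_real l) (of_real l) - pade_prim \<nu> r (of_real l) 0))"
    unfolding pade_remainder[OF \<nu>, symmetric] xl by (simp add: right_diff_distrib mult.assoc[symmetric] exp_add[symmetric])
  have "cmod (poly (pade_Y \<nu> r) (of_real x) - of_real (x powr - \<nu>) * poly (pade_X \<nu> r) (of_real x)) =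
    exp (- (\<nu> * l)) * (pade_gamma \<nu> r *
      cmod (pade_prim \<nu> r (of_real l) (of_real l) - pade_prim \<nu> r (of_real l) 0))"
    unfolding eq norm_mult norm_of_real using pade_gamma_pos[OF \<nu>(1), of r] by simp
  also have "\<dots> \<le> exp (- (\<nu> * l)) * (pade_gamma \<nu> r * (exp (\<nu> * l) * l * (cmod (1 - exp (of_real l / 2)))\<^sup>2 ^ r))"
    using l pade_gamma_pos[OF \<nu>(1), of r] by (intro mult_left_mono remainder_real_bound \<nu>) auto
  also have "\<dots> = pade_gamma \<nu> r * (l * (cmod (1 - exp (of_real l / 2))) ^ (2 * r))"
    by (simp add: power_mult exp_minus)
  also have "cmod (1 - exp (of_real l / 2)) = exp (l / 2) - 1"
    using l norm_of_real[of "1 - exp (l / 2)", where ?'a = complex] by (simp add: exp_of_real[symmetric])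
  also have "l * (exp (l / 2) - 1) ^ (2 * r) \<le> (x - 1) * (x - 1) ^ (2 * r)"
  proof (intro mult_mono power_mono)
    show "l \<le> x - 1" using exp_ge_add_one_self[of l] l by simp
    show "exp (l / 2) - 1 \<le> x - 1" using l by (simp add: l(2)[symmetric])
  qed (use x l in auto)
  finally show ?thesis using pade_gamma_pos[OF \<nu>(1), of r] by (simp add: mult_left_mono)
qed

text \<open>By degree and divisibility the determinant is a constant times
  \<open>(z - 1)^(2 * r + 1)\<close>, and its value at 0 shows that the constant is nonzero.\<close>

lemma pade_det_nonzero:
  assumes \<nu>: "0 < \<nu>" "\<nu> < 1" and z: "z \<noteq> 1"
  shows "poly (pade_X \<nu> r) z * poly (pade_Y \<nu> (Suc r)) z \<noteq> poly (pade_X \<nu> (Suc r)) z * poly (pade_Y \<nu> r) z"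
proof -
  define W where "W = pade_X \<nu> r * pade_Y \<nu> (Suc r) - pade_X \<nu> (Suc r) * pade_Y \<nu> r"
  have deg: "degree W \<le> 2 * r + 1"
    unfolding W_def
    by (intro degree_diff_le order_trans[OF degree_mult_le])
       (use degree_pade_X[of \<nu> r] degree_pade_X[of \<nu> "Suc r"] degree_pade_Y[of \<nu> r] degree_pade_Y[of \<nu> "Suc r"] in linarith)+
  have W0: "poly W 0 \<noteq> 0"
    using pade_coeff_top_Suc[OF \<nu>, of r] \<nu> by (simp add: W_def poly_pade_X_0 poly_pade_Y_0)
  obtain m1 where m1: "\<And>z. cmod z \<le> 2 \<Longrightarrow> cmod (poly (pade_X \<nu> r) z) \<le> m1"
    using poly_bound_exists[of 2 "pade_X \<nu> r"] by blast
  obtain m2 where m2: "\<And>z. cmod z \<le> 2 \<Longrightarrow> cmod (poly (pade_X \<nu> (Suc r)) z) \<le> m2"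
    using poly_bound_exists[of 2 "pade_X \<nu> (Suc r)"] by blast
  have "[:-1, 1:] ^ (2 * r + 1) dvd W"
  proof (rule power_dvd_if_small_near_1)
    fix x :: real assume x: "1 < x" "x < 2"
    define e where "e = (\<lambda>r. poly (pade_Y \<nu> r) (of_real x) - of_real (x powr - \<nu>) * poly (pade_X \<nu> r) (of_real x))"
    have e: "cmod (e s) \<le> pade_gamma \<nu> s * (x - 1) ^ (2 * r + 1)" if "s \<ge> r" for s
    proof -
      have "cmod (e s) \<le> pade_gamma \<nu> s * (x - 1) ^ (2 * s + 1)"
        unfolding e_def by (rule pade_remainder_near_1[OF \<nu> x(1)])
      also have "\<dots> \<le> pade_gamma \<nu> s * (x - 1) ^ (2 * r + 1)"
        using x that pade_gamma_pos[OF \<nu>(1), of s] by (intro mult_left_mono power_decreasing) auto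
      finally show ?thesis .
    qed
    \<comment> \<open>The terms with \<open>x powr - \<nu>\<close> cancel, so each product left
      contains a small \<open>e r\<close> or \<open>e (Suc r)\<close>.\<close>
    have "poly W (of_real x) = poly (pade_X \<nu> r) (of_real x) * e (Suc r) - poly (pade_X \<nu> (Suc r)) (of_real x) * e r"
      by (simp add: W_def e_def algebra_simps)
    then have "cmod (poly W (of_real x)) \<le> cmod (poly (pade_X \<nu> r) (of_real x)) * cmod (e (Suc r)) +
        cmod (poly (pade_X \<nu> (Suc r)) (of_real x)) * cmod (e r)"
      by (simp only: norm_triangle_ineq4 flip: norm_mult)
    also have "\<dots> \<le> m1 * (pade_gamma \<nu> (Suc r) * (x - 1) ^ (2 * r + 1)) + m2 * (pade_gamma \<nu> r * (x - 1) ^ (2 * r + 1))"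
      using x m1[of "of_real x"] m2[of "of_real x"] e[of r] e[of "Suc r"]
        order_trans[OF norm_ge_zero m1[of "of_real x"]] order_trans[OF norm_ge_zero m2[of "of_real x"]]
      by (intro add_mono mult_mono) auto
    finally show "cmod (poly W (of_real x)) \<le> (m1 * pade_gamma \<nu> (Suc r) + m2 * pade_gamma \<nu> r) * (x - 1) ^ (2 * r + 1)"
      by (simp only: distrib_right mult.assoc)
  qed
  then obtain G where G: "W = [:-1, 1:] ^ (2 * r + 1) * G" by (elim dvdE)
  have "G \<noteq> 0" using W0 G by auto
  then have "degree W = 2 * r + 1 + degree G"
    unfolding G using degree_mult_eq[of "[:-1, 1::complex:] ^ (2 * r + 1)" G]
    by (simp only: degree_linear_power power_eq_0_iff) simp
  then have "degree G = 0" using deg by simp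
  then obtain g where g: "G = [:g:]" by (metis degree_eq_zeroE)
  with \<open>G \<noteq> 0\<close> have "g \<noteq> 0" by simp
  then have "poly W z \<noteq> 0" using z by (simp add: G g)
  then show ?thesis by (simp add: W_def)
qed

section \<open>Denominators and numerators of the hypergeometric polynomials\<close>

lemma of_real_of_rat: "of_real (of_rat q) = (of_rat q :: complex)"
  by (cases q) (simp add: of_rat_rat)

text \<open>The product of the denominators is admissible, so \<open>LEAST\<close> ranges over a
  nonempty set.\<close>

lemma hyp_D_props: "hyp_D n r > 0 \<and> (\<forall>i. coeff (Polynomial.smult (of_nat (hyp_D n r)) (hyp_X n r)) i \<in> \<int>)"
  unfolding hyp_D_def
proof (rule LeastI_ex)
  let ?X = "hyp_X n r"
  define den where "den = (\<lambda>i. nat (snd (quotient_of (coeff ?X i))))"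
  define D where "D = (\<Prod>i\<le>degree ?X. den i)"
  have den_pos: "den i > 0" for i using quotient_of_denom_pos'[of "coeff ?X i"] by (simp add: den_def)
  have "of_nat D * coeff ?X i \<in> \<int>" for i
  proof (cases "i \<le> degree ?X")
    case True
    then have "den i dvd D" unfolding D_def by (intro dvd_prodI) auto
    then obtain e where e: "D = den i * e" by (elim dvdE)
    obtain p q where pq: "quotient_of (coeff ?X i) = (p, q)" by fastforce
    have q: "q > 0" "coeff ?X i = of_int p / of_int q"
      using quotient_of_denom_pos[OF pq] quotient_of_div[OF pq] by auto
    have "of_nat (den i) = (of_int q :: rat)" using pq q(1) by (simp add: den_def)
    then have "of_nat D * coeff ?X i = of_int (int e * p)" using q by (simp add: e)
    then show ?thesis by simp
  qed (simp add: coeff_eq_0)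
  moreover have "D > 0" using den_pos by (simp add: D_def)
  ultimately show "\<exists>D. D > 0 \<and> (\<forall>i. coeff (Polynomial.smult (of_nat D) ?X) i \<in> \<int>)"
    by (intro exI[of _ D]) simp
qed

lemma degree_hyp_X: "degree (hyp_X n r) \<le> r"
  by (intro degree_le) (auto simp: hyp_X_def coeff_truncate_fps)

lemma hyp_X_neq_0: "hyp_X n r \<noteq> 0"
proof -
  have "coeff (hyp_X n r) 0 = 1" by (simp add: hyp_X_def coeff_truncate_fps)
  then show ?thesis by auto
qed

lemma hyp_N_pos:
  assumes "d > 0"
  shows "hyp_N d n r > 0"
proof -
  define P where "P = pcompose (hyp_X n r) [:1, - of_nat d:]"
  have "P \<noteq> 0" unfolding P_def using assms hyp_X_neq_0 by (subst pcompose_eq_0_iff) auto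
  then have "coeff P (degree P) \<noteq> 0" by simp
  moreover obtain p q where pq: "quotient_of (coeff P (degree P)) = (p, q)" by fastforce
  ultimately have "p \<noteq> 0" using quotient_of_div[OF pq] by auto
  then have "fst (quotient_of (coeff P (degree P))) \<noteq> 0" using pq by simp
  then have "\<not> (\<lambda>i. fst (quotient_of (coeff P i))) ` {..degree P} \<subseteq> {0}" by auto
  then have "hyp_N d n r \<noteq> 0" unfolding hyp_N_def Let_def P_def[symmetric] Gcd_0_iff .
  moreover have "hyp_N d n r \<ge> 0" by (simp add: hyp_N_def Let_def)
  ultimately show ?thesis by simp
qed

text \<open>Substituting \<open>1 - d * x\<close> keeps \<open>hyp_D n r\<close> a common
  denominator. For a coefficient \<open>p / q\<close> in lowest terms, \<open>q\<close> divides
  \<open>hyp_D n r\<close> and \<open>hyp_N d n r\<close> divides \<open>p\<close>, so the two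
  divisions do not interfere.\<close>

lemma hyp_D_over_N_integral:
  fixes d n r :: nat
  defines "P \<equiv> pcompose (hyp_X n r) [:1, - of_nat d:]"
  assumes "d > 0"
  shows "of_nat (hyp_D n r) * coeff P i / of_int (hyp_N d n r) \<in> \<int>"
proof (cases "i \<le> degree P")
  case False
  then show ?thesis by (simp add: coeff_eq_0)
next
  case True
  have "coeff (Polynomial.smult (of_nat (hyp_D n r)) P) i \<in> \<int>"
    unfolding P_def pcompose_smult[symmetric]
    using hyp_D_props[of n r]
    by (intro coeff_pcompose_semiring_closed) (auto simp: coeff_pCons split: nat.splits)
  then obtain z where z: "of_nat (hyp_D n r) * coeff P i = of_int z" by (auto elim: Ints_cases)
  obtain p q where pq: "quotient_of (coeff P i) = (p, q)" by fastforce
  have q: "q > 0" "coeff P i = of_int p / of_int q" "coprime p q"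
    using quotient_of_denom_pos[OF pq] quotient_of_div[OF pq] quotient_of_coprime[OF pq] by auto
  have "of_int (int (hyp_D n r) * p) = (of_int (z * q) :: rat)"
    using z q by (simp add: field_simps)
  then have "int (hyp_D n r) * p = z * q" by (simp only: of_int_eq_iff)
  then have "q dvd int (hyp_D n r)"
    using q(3) coprime_dvd_mult_left_iff[of q p "int (hyp_D n r)"] dvd_triv_right[of q z]
    by (simp add: coprime_commute)
  then obtain f where f: "int (hyp_D n r) = q * f" by (elim dvdE)
  have "p \<in> (\<lambda>i. fst (quotient_of (coeff P i))) ` {..degree P}"
    using True pq by (intro image_eqI[of _ _ i]) auto
  then have "hyp_N d n r dvd p"
    unfolding hyp_N_def Let_def P_def[symmetric] by (rule Gcd_dvd)
  then obtain e where e: "p = hyp_N d n r * e" by (elim dvdE)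
  have "of_nat (hyp_D n r) = (of_int (q * f) :: rat)" unfolding f[symmetric] by simp
  then have "of_nat (hyp_D n r) * coeff P i / of_int (hyp_N d n r) = of_int (f * e)"
    using q hyp_N_pos[OF assms(2), of n r] by (simp add: e)
  then show ?thesis by simp
qed

lemma poly_eq_sum_atMost:
  fixes p :: "'a::comm_semiring_1 poly"
  assumes "degree p \<le> m"
  shows "poly p x = (\<Sum>i\<le>m. coeff p i * x ^ i)"
  unfolding poly_altdef using assms by (intro sum.mono_neutral_left) (auto simp: coeff_eq_0)

lemma pade_poly_eq_hyp_X:
  assumes "n \<ge> 2"
  shows "pade_poly (1 / real n) r x = poly (map_poly of_rat (hyp_X n r)) x"
proof -
  have "poly (map_poly of_rat (hyp_X n r)) x = (\<Sum>k\<le>r. coeff (map_poly of_rat (hyp_X n r)) k * x ^ k)"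
    using degree_hyp_X[of n r] by (intro poly_eq_sum_atMost) (simp add: degree_map_poly)
  then show ?thesis
    by (simp add: pade_poly_def coeff_map_poly coeff_hyp_X[OF assms, symmetric] of_real_of_rat)
qed

text \<open>With \<open>y = (b - a) / d\<close> one has \<open>a / b = 1 - d * (y / b)\<close>.
  Expanding in \<open>y / b\<close> and multiplying by \<open>b^r\<close> gives monomials
  \<open>b^(r - i) * y^i\<close>, whose scaled coefficients are integers.\<close>

lemma pade_value_integral:
  fixes n d r :: nat and a b :: complex
  assumes K: "is_subfield K" and n: "n \<ge> 2" and d: "d > 0"
    and b: "b \<in> ring_of_integers K" "b \<noteq> 0" and y: "(b - a) / of_nat d \<in> ring_of_integers K"
  shows "of_real (real (hyp_D n r) / real_of_int (hyp_N d n r)) * (b ^ r * pade_poly (1 / real n) r (a / b))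
    \<in> ring_of_integers K"
proof -
  define P where "P = pcompose (hyp_X n r) [:1, - of_nat d:]"
  define y where "y = (b - a) / of_nat d"
  define \<mu> where "\<mu> = of_nat (hyp_D n r) / (of_int (hyp_N d n r) :: rat)"
  have "\<exists>w. \<mu> * coeff P i = of_int w" for i
    using hyp_D_over_N_integral[OF d, of n r i] unfolding \<mu>_def P_def
    by (auto elim!: Ints_cases)
  then have "\<forall>i. \<exists>w. \<mu> * coeff P i = of_int w" by blast
  from choice[OF this] obtain z where z: "\<And>i. \<mu> * coeff P i = of_int (z i)" by (elim exE) simp
  have degP: "degree P \<le> r"
    using degree_pcompose_le[of "hyp_X n r" "[:1, - of_nat d:]"] degree_hyp_X[of n r] d by (simp add: P_def)
  have "of_nat d * y = b - a" using d by (simp add: y_def)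
  then have "poly (map_poly of_rat [:1, - of_nat d:]) (y / b) = a / b"
    using b(2) d by (simp add: map_poly_pCons of_rat_minus map_poly_simps field_simps)
  then have "poly (map_poly of_rat P) (y / b) = pade_poly (1 / real n) r (a / b)"
    unfolding pade_poly_eq_hyp_X[OF n] P_def of_rat_hom.map_poly_pcompose poly_pcompose by simp
  also have "poly (map_poly of_rat P) (y / b) = (\<Sum>i\<le>r. of_rat (coeff P i) * (y / b) ^ i)"
    using poly_eq_sum_atMost[of "map_poly of_rat P" r "y / b"] degP
    by (simp add: degree_map_poly coeff_map_poly)
  finally have val: "pade_poly (1 / real n) r (a / b) = (\<Sum>i\<le>r. of_rat (coeff P i) * (y / b) ^ i)" ..
  have "of_rat \<mu> * (b ^ r * pade_poly (1 / real n) r (a / b)) =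
      (\<Sum>i\<le>r. of_rat (\<mu> * coeff P i) * (b ^ r * (y / b) ^ i))"
    unfolding val sum_distrib_left by (intro sum.cong refl) (simp only: of_rat_mult mult_ac)
  also have "\<dots> = (\<Sum>i\<le>r. of_int (z i) * (b ^ (r - i) * y ^ i))"
    using b(2) by (intro sum.cong refl) (simp add: z power_divide power_diff)
  also have "\<dots> \<in> ring_of_integers K"
  proof -
    have pow: "u ^ k \<in> ring_of_integers K" if "u \<in> ring_of_integers K" for u k
      using that ring_of_integers_of_int[OF K, of 1] by (induction k) (auto intro: ring_of_integers_mult[OF K])
    have sum: "(\<Sum>i\<le>k. f i) \<in> ring_of_integers K" if "\<And>i. f i \<in> ring_of_integers K" for f and k :: nat
      using that by (induction k) (auto intro: ring_of_integers_add[OF K])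
    show ?thesis using assms(6) b(1)
      by (intro sum ring_of_integers_mult[OF K] ring_of_integers_of_int[OF K] pow) (auto simp: y_def)
  qed
  also have "of_rat \<mu> = (of_real (real (hyp_D n r) / real_of_int (hyp_N d n r)) :: complex)"
    by (simp add: \<mu>_def of_rat_divide)
  finally show ?thesis .
qed

section \<open>The irrationality measure\<close>

lemma sin_ge_third:
  assumes "0 \<le> y" "y \<le> pi / 2"
  shows "y / 3 \<le> sin y"
proof (cases "y \<le> pi / 3")
  case True
  then show ?thesis using sin_ge_half[OF assms(1) True] assms by simp
next
  case False
  have "sin (pi / 3) \<le> sin y" using False assms by (intro sin_monotone_2pi_le) auto
  moreover have "sqrt 3 / 2 \<ge> 3 / 4" using real_le_rsqrt[of "3 / 2" 3] by (simp add: power2_eq_square)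
  ultimately show ?thesis using assms pi_less_4 by (simp add: sin_60)
qed

text \<open>The chord has length \<open>2 * \<bar>sin (\<phi> / 2)\<bar>\<close>. The constant 3 is
  later absorbed by \<open>\<nu> \<le> 1 / 3\<close>.\<close>

lemma angle_le_chord:
  assumes "\<bar>\<phi>\<bar> \<le> pi"
  shows "\<bar>\<phi>\<bar> \<le> 3 * cmod (exp (\<i> * of_real \<phi>) - 1)"
proof -
  have "(cmod (exp (\<i> * of_real \<phi>) - 1))\<^sup>2 = (2 * sin (\<phi> / 2))\<^sup>2"
  proof -
    have c: "cos \<phi> = 1 - 2 * (sin (\<phi> / 2))\<^sup>2" using cos_double_sin[of "\<phi> / 2"] by simp
    have "(cmod (exp (\<i> * of_real \<phi>) - 1))\<^sup>2 = (cos \<phi> - 1)\<^sup>2 + (sin \<phi>)\<^sup>2"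
      by (simp add: cmod_power2 Re_exp Im_exp)
    also have "\<dots> = 2 - 2 * cos \<phi>"
      using sin_cos_squared_add[of \<phi>] by (simp add: power2_diff)
    finally show ?thesis by (simp add: c power_mult_distrib)
  qed
  then have "cmod (exp (\<i> * of_real \<phi>) - 1) = \<bar>2 * sin (\<phi> / 2)\<bar>"
    using norm_ge_zero[of "exp (\<i> * of_real \<phi>) - 1"] unfolding power2_eq_iff by arith
  moreover have "\<bar>\<phi>\<bar> / 2 / 3 \<le> sin (\<bar>\<phi>\<bar> / 2)" using assms by (intro sin_ge_third) auto
  moreover have "sin (\<bar>\<phi>\<bar> / 2) \<le> \<bar>sin (\<phi> / 2)\<bar>" by (auto simp: abs_if)
  ultimately show ?thesis by (simp add: abs_mult)
qed

text \<open>Unites the real and the circular case, with constants \<open>5/4\<close> and 2 that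
  double to the \<open>5/2\<close> and 4 of \<open>c\<close>. The sign of \<open>- L\<close> is due
  to the denominators, which are values at \<open>b / a\<close>.\<close>

lemma pade_estimates:
  fixes a b :: complex and \<nu> :: real
  assumes \<nu>: "0 < \<nu>" "\<nu> \<le> 1 / 3" and a: "cmod a \<ge> 1" and b: "cmod b \<ge> 1"
    and ab: "(\<exists>t::rat. a / b = of_rat t \<and> t > 1) \<or> cmod (a / b) = 1"
  obtains L where "exp L = a / b" "L = Ln (a / b)" "Re (exp (L / 2)) \<ge> 0"
    "\<And>r. \<nu> * cmod (pade_prim \<nu> r L L - pade_prim \<nu> r L 0) \<le>
       5 / 4 * cmod a * cmod (a / b - 1) * (cmod (1 - exp (L / 2)))\<^sup>2 ^ r"
    "\<And>r. \<nu> * cmod (pade_prim \<nu> r (- L) 0) \<le> 2 * cmod a * (cmod (1 + exp (- L / 2)))\<^sup>2 ^ r"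
proof -
  define x where "x = a / b"
  have "a \<noteq> 0" "b \<noteq> 0" using a b by auto
  then have x0: "x \<noteq> 0" by (simp add: x_def)
  have \<nu>1: "\<nu> < 1" using \<nu> by simp
  have expL: "exp (Ln x) = x" using x0 by simp
  have sq_nonneg: "(cmod z)\<^sup>2 ^ r \<ge> 0" for z r by simp
  from ab show ?thesis unfolding x_def[symmetric]
  proof
    assume "\<exists>t::rat. x = of_rat t \<and> t > 1"
    then obtain t :: rat where t: "x = of_rat t" "t > 1" by blast
    define y where "y = (of_rat t :: real)"
    have y: "y > 1" "x = of_real y" using t by (simp_all add: y_def of_real_of_rat)
    define l where "l = ln y"
    have l: "l > 0" "exp l = y" using y by (simp_all add: l_def)
    have L: "Ln x = of_real l" using y by (simp add: l_def Ln_of_real)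
    have ly: "l \<le> y - 1" using exp_ge_add_one_self[of l] l by simp
    have ya: "y \<le> cmod a"
    proof -
      have "a = x * b" using \<open>b \<noteq> 0\<close> by (simp add: x_def)
      then have "cmod a = y * cmod b" using y by (simp add: norm_mult)
      then show ?thesis using b y by simp
    qed
    have nx: "cmod (x - 1) = y - 1" using y norm_of_real[of "y - 1", where ?'a = complex] by simp
    show ?thesis
    proof (rule that[of "Ln x", folded x_def])
      show "0 \<le> Re (exp (Ln x / 2))" by (simp add: L Re_exp)
      fix r
      have "\<nu> * cmod (pade_prim \<nu> r (of_real l) (of_real l) - pade_prim \<nu> r (of_real l) 0) \<le>
          \<nu> * (exp (\<nu> * l) * l * (cmod (1 - exp (of_real l / 2)))\<^sup>2 ^ r)"
        using \<nu> l by (intro mult_left_mono remainder_real_bound) auto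
      also have "\<dots> = (\<nu> * exp (\<nu> * l) * l) * (cmod (1 - exp (of_real l / 2)))\<^sup>2 ^ r"
        by (simp only: mult_ac)
      also have "\<dots> \<le> (5 / 4 * cmod a * (y - 1)) * (cmod (1 - exp (of_real l / 2)))\<^sup>2 ^ r"
      proof (intro mult_right_mono mult_mono sq_nonneg)
        \<comment> \<open>Hence \<open>exp (\<nu> * l) \<le> y\<close>, and
          \<open>y \<le> cmod a\<close> because \<open>cmod b \<ge> 1\<close>.\<close>
        have "\<nu> * l \<le> l" using \<nu> l by simp
        then have "exp (\<nu> * l) \<le> cmod a" using ya l(2) by (metis exp_le_cancel_iff order_trans)
        then show "exp (\<nu> * l) \<le> cmod a" .
      qed (use \<nu> l ly y in auto)
      finally show "\<nu> * cmod (pade_prim \<nu> r (Ln x) (Ln x) - pade_prim \<nu> r (Ln x) 0) \<le>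
          5 / 4 * cmod a * cmod (x - 1) * (cmod (1 - exp (Ln x / 2)))\<^sup>2 ^ r"
        unfolding L nx .
      have "\<nu> * cmod (pade_prim \<nu> r (of_real (- l)) 0) \<le>
          (2 - \<nu> * (- l) / 2) * (cmod (1 + exp (of_real (- l) / 2)))\<^sup>2 ^ r"
        using \<nu> l by (intro prim_0_real_bound) auto
      also have "\<dots> \<le> 2 * cmod a * (cmod (1 + exp (of_real (- l) / 2)))\<^sup>2 ^ r"
      proof (intro mult_right_mono sq_nonneg)
        \<comment> \<open>As \<open>l \<le> y - 1 \<le> cmod a - 1\<close>, the left side below is
          at most \<open>2 + (cmod a - 1) / 2\<close>.\<close>
        have "\<nu> * l \<le> l" using \<nu> l by simp
        then show "2 - \<nu> * (- l) / 2 \<le> 2 * cmod a" using ly ya a by simp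
      qed
      finally show "\<nu> * cmod (pade_prim \<nu> r (- Ln x) 0) \<le> 2 * cmod a * (cmod (1 + exp (- Ln x / 2)))\<^sup>2 ^ r"
        unfolding L by simp
    qed (simp_all add: expL)
  next
    assume x1: "cmod x = 1"
    define \<phi> where "\<phi> = Arg x"
    have \<phi>: "\<bar>\<phi>\<bar> \<le> pi" "\<bar>- \<phi>\<bar> \<le> pi" using Arg_bounded[of x] by (auto simp: \<phi>_def)
    have L: "Ln x = \<i> * of_real \<phi>" using Ln_Arg[OF x0] x1 by (simp add: \<phi>_def)
    show ?thesis
    proof (rule that[of "Ln x", folded x_def])
      show "0 \<le> Re (exp (Ln x / 2))" using \<phi> by (simp add: L Re_exp cos_ge_zero)
      fix r
      have "\<nu> * cmod (pade_prim \<nu> r (Ln x) (Ln x) - pade_prim \<nu> r (Ln x) 0) \<le>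
          \<nu> * (\<bar>\<phi>\<bar> * (cmod (1 - exp (Ln x / 2)))\<^sup>2 ^ r)"
        unfolding L using \<nu> \<phi> by (intro mult_left_mono remainder_circle_bound) auto
      also have "\<dots> = (\<nu> * \<bar>\<phi>\<bar>) * (cmod (1 - exp (Ln x / 2)))\<^sup>2 ^ r" by (simp only: mult_ac)
      also have "\<dots> \<le> (5 / 4 * cmod a * cmod (x - 1)) * (cmod (1 - exp (Ln x / 2)))\<^sup>2 ^ r"
      proof (intro mult_right_mono sq_nonneg)
        have "\<nu> * \<bar>\<phi>\<bar> \<le> 1 / 3 * (3 * cmod (x - 1))"
          using angle_le_chord[OF \<phi>(1)] \<nu> expL unfolding L by (intro mult_mono) auto
        also have "\<dots> \<le> 5 / 4 * cmod a * cmod (x - 1)"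
          using a mult_right_mono[of 1 "5 / 4 * cmod a" "cmod (x - 1)"] by simp
        finally show "\<nu> * \<bar>\<phi>\<bar> \<le> 5 / 4 * cmod a * cmod (x - 1)" .
      qed
      finally show "\<nu> * cmod (pade_prim \<nu> r (Ln x) (Ln x) - pade_prim \<nu> r (Ln x) 0) \<le>
          5 / 4 * cmod a * cmod (x - 1) * (cmod (1 - exp (Ln x / 2)))\<^sup>2 ^ r" .
      have "\<nu> * cmod (pade_prim \<nu> r (\<i> * of_real (- \<phi>)) 0) \<le> 2 * (cmod (1 + exp (\<i> * of_real (- \<phi>) / 2)))\<^sup>2 ^ r"
        using \<nu> \<phi> by (intro prim_0_circle_bound) auto
      also have "\<dots> \<le> 2 * cmod a * (cmod (1 + exp (\<i> * of_real (- \<phi>) / 2)))\<^sup>2 ^ r"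
        using a by (intro mult_right_mono sq_nonneg) auto
      finally show "\<nu> * cmod (pade_prim \<nu> r (- Ln x) 0) \<le> 2 * cmod a * (cmod (1 + exp (- Ln x / 2)))\<^sup>2 ^ r"
        unfolding L by simp
    qed (simp_all add: expL)
  qed
qed

text \<open>With \<open>w = exp (L / 2)\<close>, a square root of \<open>a / b\<close>,
  \<open>csqrt a\<close> is \<open>csqrt b * w\<close> up to sign. The sign only exchanges the two
  moduli, and \<open>Re w \<ge> 0\<close> makes \<open>1 - w\<close> the smaller factor.\<close>

lemma min_max_csqrt:
  assumes b: "b \<noteq> 0" and L: "exp L = a / b" and re: "Re (exp (L / 2)) \<ge> 0"
  shows "(min (cmod (csqrt a - csqrt b)) (cmod (csqrt a + csqrt b)))\<^sup>2 = cmod b * (cmod (1 - exp (L / 2)))\<^sup>2"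
    and "(max (cmod (csqrt a - csqrt b)) (cmod (csqrt a + csqrt b)))\<^sup>2 = cmod a * (cmod (1 + exp (- L / 2)))\<^sup>2"
proof -
  define w v where "w = exp (L / 2)" and "v = csqrt b"
  have w2: "w\<^sup>2 = a / b" unfolding w_def power2_eq_square exp_add[symmetric] L[symmetric] by simp
  have v2: "v\<^sup>2 = b" by (simp add: v_def)
  have nv: "(cmod v)\<^sup>2 = cmod b" by (simp add: norm_power[symmetric] v2)
  have "(csqrt a)\<^sup>2 = (v * w)\<^sup>2" using b by (simp add: power_mult_distrib v2 w2)
  then have "csqrt a = v * w \<or> csqrt a = - (v * w)" by (simp only: power2_eq_iff)
  then have cases: "cmod (csqrt a - csqrt b) = cmod v * cmod (1 - w) \<and> cmod (csqrt a + csqrt b) = cmod v * cmod (1 + w) \<or>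
    cmod (csqrt a - csqrt b) = cmod v * cmod (1 + w) \<and> cmod (csqrt a + csqrt b) = cmod v * cmod (1 - w)"
  proof
    assume *: "csqrt a = v * w"
    have "v * w - v = - (v * (1 - w))" "v * w + v = v * (1 + w)" by (simp_all add: algebra_simps)
    then show ?thesis unfolding * v_def[symmetric] by (simp only: norm_minus_cancel norm_mult simp_thms)
  next
    assume *: "csqrt a = - (v * w)"
    have "- (v * w) - v = - (v * (1 + w))" "- (v * w) + v = v * (1 - w)" by (simp_all add: algebra_simps)
    then show ?thesis unfolding * v_def[symmetric] by (simp only: norm_minus_cancel norm_mult simp_thms)
  qed
  have "\<bar>1 - Re w\<bar> \<le> \<bar>1 + Re w\<bar>" using re unfolding w_def[symmetric] by arith
  then have "(1 - Re w)\<^sup>2 \<le> (1 + Re w)\<^sup>2" by (simp only: abs_le_square_iff)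
  then have "(cmod (1 - w))\<^sup>2 \<le> (cmod (1 + w))\<^sup>2" by (simp add: cmod_power2)
  then have "cmod (1 - w) \<le> cmod (1 + w)" by (rule power2_le_imp_le) simp
  then have le: "cmod v * cmod (1 - w) \<le> cmod v * cmod (1 + w)" by (intro mult_left_mono) auto
  have mn: "min (cmod (csqrt a - csqrt b)) (cmod (csqrt a + csqrt b)) = cmod v * cmod (1 - w)"
    using cases by (elim disjE conjE) (simp_all only: min_absorb1[OF le] min_absorb2[OF le])
  have mx: "max (cmod (csqrt a - csqrt b)) (cmod (csqrt a + csqrt b)) = cmod v * cmod (1 + w)"
    using cases by (elim disjE conjE) (simp_all only: max_absorb1[OF le] max_absorb2[OF le])
  show "(min (cmod (csqrt a - csqrt b)) (cmod (csqrt a + csqrt b)))\<^sup>2 = cmod b * (cmod (1 - exp (L / 2)))\<^sup>2"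
    unfolding mn power_mult_distrib nv w_def ..
  have "1 + w = w * (1 + exp (- L / 2))" by (simp add: w_def distrib_left exp_add[symmetric])
  then have "(cmod (1 + w))\<^sup>2 = cmod (a / b) * (cmod (1 + exp (- L / 2)))\<^sup>2"
    by (simp only: norm_mult power_mult_distrib norm_power[symmetric] w2)
  then show "(max (cmod (csqrt a - csqrt b)) (cmod (csqrt a + csqrt b)))\<^sup>2 = cmod a * (cmod (1 + exp (- L / 2)))\<^sup>2"
    unfolding mx power_mult_distrib nv using b by (simp add: norm_divide)
qed

text \<open>Take the first \<open>r0\<close> at which the remainder bound times
  \<open>cmod v\<close> falls below \<open>1/2\<close>. For \<open>r = r0\<close> or
  \<open>r = r0 + 1\<close> the integer \<open>u * q r - v * p r\<close> is nonzero, and more than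
  \<open>1/2\<close> of its modulus must come from \<open>\<theta> - u / v\<close>.\<close>

lemma irrationality_measure_from_approximations:
  fixes p q :: "nat \<Rightarrow> complex" and \<theta> u v :: complex and E Q k0 l0 \<kappa> :: real
  assumes sub: "is_subfield K" and norm1: "\<And>z. z \<in> ring_of_integers K \<Longrightarrow> z \<noteq> 0 \<Longrightarrow> cmod z \<ge> 1"
    and pq: "\<And>r. p r \<in> ring_of_integers K" "\<And>r. q r \<in> ring_of_integers K"
    and det: "\<And>r. p r * q (Suc r) \<noteq> p (Suc r) * q r"
    and q: "\<And>r. cmod (q r) \<le> k0 * Q ^ r"
    and rem: "\<And>r. cmod (\<theta> * q r - p r) \<le> l0 / E ^ r"
    and pos: "k0 > 0" "l0 > 0" "Q > 0" "E > 1" and l0E: "2 * l0 * E \<ge> 1" and \<kappa>: "\<kappa> = ln Q / ln E"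
    and u: "u \<in> ring_of_integers K" and v: "v \<in> ring_of_integers K" "v \<noteq> 0"
  shows "cmod (\<theta> - u / v) > 1 / (2 * k0 * Q * (2 * l0 * E) powr \<kappa> * cmod v powr (\<kappa> + 1))"
proof -
  \<comment> \<open>Otherwise the integers \<open>q r\<close> would eventually have modulus below 1
    and vanish, against \<open>det\<close>. This yields \<open>\<kappa> \<ge> 0\<close>.\<close>
  have Q1: "Q \<ge> 1"
  proof (rule ccontr)
    assume "\<not> Q \<ge> 1"
    then have "(\<lambda>r. k0 * Q ^ r) \<longlonglongrightarrow> k0 * 0" using pos by (intro tendsto_mult tendsto_const LIMSEQ_realpow_zero) auto
    then have "\<forall>\<^sub>F r in sequentially. k0 * Q ^ r < 1" by (intro order_tendstoD) auto
    then obtain R where R: "\<And>r. r \<ge> R \<Longrightarrow> k0 * Q ^ r < 1" by (auto simp: eventually_sequentially)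
    have "q r = 0" if "r \<ge> R" for r
    proof (rule ccontr)
      assume "q r \<noteq> 0"
      then show False using norm1[OF pq(2)[of r]] R[OF that] q[of r] by linarith
    qed
    from this[of R] this[of "Suc R"] show False using det[of R] by simp
  qed
  have \<kappa>0: "\<kappa> \<ge> 0" using Q1 pos by (simp add: \<kappa>)
  have v1: "cmod v \<ge> 1" using norm1[OF v] .
  have EQ: "(E ^ r) powr \<kappa> = Q ^ r" for r
  proof -
    have "(E ^ r) powr \<kappa> = exp (\<kappa> * (real r * ln E))" using pos by (simp add: powr_def ln_realpow)
    also have "\<kappa> * (real r * ln E) = real r * ln Q" using pos by (simp add: \<kappa>)
    finally show ?thesis using pos by (simp add: exp_of_nat_mult)
  qed
  have "\<exists>r. l0 * cmod v / E ^ r < 1 / 2"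
  proof -
    have "(\<lambda>r. l0 * cmod v / E ^ r) \<longlonglongrightarrow> 0" using pos by (intro LIMSEQ_divide_realpow_zero) auto
    then have "\<forall>\<^sub>F r in sequentially. l0 * cmod v / E ^ r < 1 / 2" by (intro order_tendstoD) auto
    then show ?thesis by (auto simp: eventually_sequentially)
  qed
  define r0 where "r0 = (LEAST r. l0 * cmod v / E ^ r < 1 / 2)"
  have r0: "l0 * cmod v / E ^ r0 < 1 / 2" unfolding r0_def by (rule LeastI_ex) fact
  \<comment> \<open>For \<open>r0 = 0\<close> this rests on \<open>l0E\<close>. Otherwise minimality
    gives \<open>E^(r0 - 1) \<le> 2 * l0 * cmod v\<close>, and raising to the power
    \<open>\<kappa>\<close> turns powers of \<open>E\<close> into powers of
    \<open>Q\<close>.\<close>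
  have Qr0: "Q ^ r0 \<le> (2 * l0 * E * cmod v) powr \<kappa>"
  proof (cases r0)
    case 0
    have "1 * 1 \<le> 2 * l0 * E * cmod v" using l0E v1 pos by (intro mult_mono) auto
    then show ?thesis using \<kappa>0 0 pos by (simp add: ge_one_powr_ge_zero)
  next
    case (Suc s)
    then have "\<not> l0 * cmod v / E ^ s < 1 / 2" using not_less_Least[of s "\<lambda>r. l0 * cmod v / E ^ r < 1 / 2"] by (simp add: r0_def)
    then have "E ^ s \<le> 2 * l0 * cmod v" using pos by (simp add: field_simps)
    then have "E ^ r0 \<le> 2 * l0 * E * cmod v" using pos mult_left_mono[of "E ^ s" "2 * l0 * cmod v" E] by (simp add: Suc mult_ac)
    then have "(E ^ r0) powr \<kappa> \<le> (2 * l0 * E * cmod v) powr \<kappa>" using \<kappa>0 pos by (intro powr_mono2) auto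
    then show ?thesis by (simp only: EQ)
  qed
  have "\<exists>r. r0 \<le> r \<and> r \<le> Suc r0 \<and> u * q r \<noteq> v * p r"
  proof (rule ccontr)
    assume "\<not> (\<exists>r. r0 \<le> r \<and> r \<le> Suc r0 \<and> u * q r \<noteq> v * p r)"
    then have eq: "u * q r0 = v * p r0" "u * q (Suc r0) = v * p (Suc r0)" by auto
    have "v * (p r0 * q (Suc r0)) = (u * q r0) * q (Suc r0)" by (simp only: eq mult.assoc)
    also have "\<dots> = (u * q (Suc r0)) * q r0" by (simp only: mult_ac)
    also have "\<dots> = v * (p (Suc r0) * q r0)" by (simp only: eq mult.assoc)
    finally have "v * (p r0 * q (Suc r0)) = v * (p (Suc r0) * q r0)" .
    then show False using det[of r0] v by simp
  qed
  then obtain r where r: "r0 \<le> r" "r \<le> Suc r0" "u * q r \<noteq> v * p r" by blast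
  have "1 \<le> cmod (u * q r - v * p r)"
    using r(3) by (intro norm1 ring_of_integers_diff[OF sub] ring_of_integers_mult[OF sub] u v pq) auto
  also have "u * q r - v * p r = v * (\<theta> * q r - p r) - q r * v * (\<theta> - u / v)"
    using v by (simp add: algebra_simps)
  also have "cmod \<dots> \<le> cmod v * cmod (\<theta> * q r - p r) + cmod (q r) * cmod v * cmod (\<theta> - u / v)"
    by (rule order_trans[OF norm_triangle_ineq4]) (simp add: norm_mult)
  also have "cmod v * cmod (\<theta> * q r - p r) < 1 / 2"
  proof -
    have "cmod v * cmod (\<theta> * q r - p r) \<le> cmod v * (l0 / E ^ r)" by (intro mult_left_mono rem) auto
    also have "\<dots> \<le> cmod v * (l0 / E ^ r0)"
      using pos r(1) by (intro mult_left_mono divide_left_mono power_increasing) auto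
    also have "\<dots> < 1 / 2" using r0 by (simp add: mult.commute)
    finally show ?thesis .
  qed
  also have "cmod (q r) * cmod v * cmod (\<theta> - u / v) \<le> (k0 * Q * (2 * l0 * E * cmod v) powr \<kappa>) * cmod v * cmod (\<theta> - u / v)"
  proof (intro mult_right_mono)
    \<comment> \<open>Allowing \<open>r = r0 + 1\<close> costs the separate factor \<open>Q\<close>
      in the conclusion.\<close>
    have "Q ^ r \<le> Q ^ Suc r0" using Q1 r(2) by (intro power_increasing)
    also have "\<dots> \<le> Q * (2 * l0 * E * cmod v) powr \<kappa>" using Qr0 pos by simp
    finally have "k0 * Q ^ r \<le> k0 * (Q * (2 * l0 * E * cmod v) powr \<kappa>)" using pos by simp
    then show "cmod (q r) \<le> k0 * Q * (2 * l0 * E * cmod v) powr \<kappa>" using q[of r] by (simp add: mult.assoc)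
  qed auto
  finally have "1 / 2 < (k0 * Q * (2 * l0 * E * cmod v) powr \<kappa>) * cmod v * cmod (\<theta> - u / v)" by simp
  also have "(2 * l0 * E * cmod v) powr \<kappa> = (2 * l0 * E) powr \<kappa> * cmod v powr \<kappa>"
    using pos by (simp add: powr_mult)
  finally have "1 < (2 * k0 * Q * (2 * l0 * E) powr \<kappa> * cmod v powr (\<kappa> + 1)) * cmod (\<theta> - u / v)"
    using v1 by (simp add: powr_add mult_ac)
  moreover have "0 < 2 * k0 * Q * (2 * l0 * E) powr \<kappa> * cmod v powr (\<kappa> + 1)"
    using pos v by (intro mult_pos_pos) auto
  ultimately show ?thesis by (simp add: field_simps)
qed

lemma cal_N_pos: "cal_N d n > 0"
  unfolding cal_N_def by (intro prod_pos) (auto dest: prime_gt_0_nat simp: in_prime_factors_iff)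

lemma pade_gamma_Gamma:
  assumes "n \<ge> 1"
  shows "pade_gamma (1 / real n) r =
    1 / real n * (real n * Gamma (real r + 1 + 1 / real n) / (Gamma (1 / real n) * fact r))"
proof -
  have "1 / real n \<notin> \<int>\<^sub>\<le>\<^sub>0" using assms by (auto dest: nonpos_Ints_nonpos)
  then have "pochhammer (1 / real n) (Suc r) = Gamma (1 / real n + of_nat (Suc r)) / Gamma (1 / real n)"
    by (rule pochhammer_Gamma)
  then show ?thesis using assms by (simp add: pade_gamma_def add_ac)
qed

lemma hyp_N_degree_0: "hyp_N d n 0 = 1"
proof -
  have "hyp_X n 0 = 1"
    by (rule poly_eqI) (simp add: hyp_X_def coeff_truncate_fps coeff_1)
  then show ?thesis by (simp add: hyp_N_def Let_def pcompose_1)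
qed

theorem corollary2p6:
  fixes K :: "complex set" and n d :: nat and a b :: complex
    and Cn Dn E Q \<kappa> c :: real
  assumes "imaginary_quadratic_field K"
    and "n \<ge> 3"
    and "a \<in> ring_of_integers K" and "b \<in> ring_of_integers K"
    and "b \<noteq> 0" and "a \<noteq> b"
    and "ideal2 (ring_of_integers K) a b = ring_of_integers K"
    and "(\<exists>t::rat. a / b = of_rat t \<and> t > 1) \<or> (cmod (a / b) = 1 \<and> a / b \<noteq> -1)"
    and "d > 0" and "algebraic_int ((a - b) / of_nat d)"
    and "\<And>m::nat. m > 0 \<Longrightarrow> algebraic_int ((a - b) / of_nat m) \<Longrightarrow> m \<le> d"
    and "Cn > 0" and "Dn > 0"
    and "\<And>r::nat.
      Max {1, Gamma (1 - 1 / real n) * fact r / Gamma (real r + 1 - 1 / real n),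
           real n * Gamma (real r + 1 + 1 / real n) / (Gamma (1 / real n) * fact r)}
        * (real (hyp_D n r) / real_of_int (hyp_N d n r))
      < Cn * (Dn / cal_N d n) ^ r"
    and "E = cal_N d n / Dn *
      inverse ((min (cmod (princ_root 2 a - princ_root 2 b))
                    (cmod (princ_root 2 a + princ_root 2 b)))\<^sup>2)"
    and "Q = Dn / cal_N d n *
      (max (cmod (princ_root 2 a - princ_root 2 b))
           (cmod (princ_root 2 a + princ_root 2 b)))\<^sup>2"
    and "\<kappa> = ln Q / ln E"
    and "c = 4 * cmod a * Cn * Q * (5 / 2 * cmod (a * (a - b) / b) * Cn * E) powr \<kappa>"
    and "E > 1"
  shows "\<forall>p\<in>ring_of_integers K. \<forall>q\<in>ring_of_integers K. q \<noteq> 0 \<longrightarrow>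
    cmod (princ_root n (a / b) - p / q) > 1 / (c * cmod q powr (\<kappa> + 1))"
proof (intro ballI impI)
  fix p q assume p: "p \<in> ring_of_integers K" and q: "q \<in> ring_of_integers K" "q \<noteq> 0"
  note K = assms(1) and n = assms(2) and a = assms(3) and b = assms(4) and b0 = assms(5)
    and ab = assms(6) and ratio = assms(8) and d = assms(9) and dvd = assms(10) and C = assms(12)
    and Dn = assms(13) and bound = assms(14) and E1 = assms(19)
  have sub: "is_subfield K" using K by (simp add: imaginary_quadratic_field_def)
  note norm1 = ring_of_integers_norm_ge_1[OF K]
  define \<nu> where "\<nu> = 1 / real n"
  have \<nu>: "0 < \<nu>" "\<nu> \<le> 1 / 3" "\<nu> < 1" using n by (simp_all add: \<nu>_def field_simps)
  define x where "x = a / b"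
  have x_ge: "cmod x \<ge> 1" using ratio unfolding x_def[symmetric]
  proof (elim disjE exE conjE)
    fix t :: rat assume t: "x = of_rat t" "t > 1"
    then have "x = of_real (of_rat t)" by (simp add: of_real_of_rat)
    then show ?thesis using t(2) by simp
  qed simp
  have a0: "a \<noteq> 0" using x_ge by (auto simp: x_def)
  have na: "cmod a \<ge> 1" and nb: "cmod b \<ge> 1" using norm1[OF a a0] norm1[OF b b0] by auto
  have nab: "cmod (a - b) \<ge> 1" using norm1[OF ring_of_integers_diff[OF sub a b]] ab by simp
  have x1: "x \<noteq> 1" using ab b0 by (simp add: x_def)
  obtain L where L: "exp L = x" "L = Ln x" "Re (exp (L / 2)) \<ge> 0"
    and est1: "\<And>r. \<nu> * cmod (pade_prim \<nu> r L L - pade_prim \<nu> r L 0) \<le>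
       5 / 4 * cmod a * cmod (x - 1) * (cmod (1 - exp (L / 2)))\<^sup>2 ^ r"
    and est2: "\<And>r. \<nu> * cmod (pade_prim \<nu> r (- L) 0) \<le> 2 * cmod a * (cmod (1 + exp (- L / 2)))\<^sup>2 ^ r"
    unfolding x_def using ratio by (rule_tac pade_estimates[OF \<nu>(1,2) na nb]) auto
  define \<theta> where "\<theta> = princ_root n x"
  \<comment> \<open>Since \<open>L\<close> is the principal logarithm, this exponential is the
    principal root and not another one.\<close>
  have \<theta>: "\<theta> = exp (of_real \<nu> * L)"
    using x_ge n by (auto simp: \<theta>_def princ_root_eq_powr powr_def L(2) \<nu>_def)
  define \<Lambda> where "\<Lambda> = Dn / cal_N d n"
  have \<Lambda>: "\<Lambda> > 0" using Dn cal_N_pos by (simp add: \<Lambda>_def)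
  note mm = min_max_csqrt[OF b0 L(1)[unfolded x_def] L(3), folded princ_root_2]
  define m2 where "m2 = cmod b * (cmod (1 - exp (L / 2)))\<^sup>2"
  define M2 where "M2 = cmod a * (cmod (1 + exp (- L / 2)))\<^sup>2"
  \<comment> \<open>Thus remainders decay like \<open>(\<Lambda> * m2)^r = 1 / E^r\<close> and
    denominators grow at most like \<open>(\<Lambda> * M2)^r = Q^r\<close>.\<close>
  have E: "E = 1 / (\<Lambda> * m2)" unfolding assms(15) mm m2_def \<Lambda>_def by (simp add: field_simps)
  have Q: "Q = \<Lambda> * M2" unfolding assms(16) mm M2_def \<Lambda>_def ..
  define \<mu> where "\<mu> = (\<lambda>r. real (hyp_D n r) / real_of_int (hyp_N d n r))"
  have \<mu>: "\<mu> r > 0" for r using hyp_D_props[of n r] hyp_N_pos[OF d, of n r] by (simp add: \<mu>_def)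
  define G where "G = (\<lambda>r. real n * Gamma (real r + 1 + 1 / real n) / (Gamma (1 / real n) * fact r))"
  \<comment> \<open>This \<open>\<nu>\<close> is the one on the left of \<open>est1\<close> and
    \<open>est2\<close>, while \<open>G r\<close> is covered by the hypothesis on
    \<open>Cn\<close>.\<close>
  have \<gamma>: "pade_gamma \<nu> r = \<nu> * G r" for r
    unfolding \<nu>_def G_def using n by (intro pade_gamma_Gamma) simp
  have \<mu>1: "1 * \<mu> r \<le> Cn * \<Lambda> ^ r" and \<mu>G: "G r * \<mu> r \<le> Cn * \<Lambda> ^ r" for r
  proof -
    let ?S = "{1, Gamma (1 - 1 / real n) * fact r / Gamma (real r + 1 - 1 / real n), G r}"
    have "Max ?S * \<mu> r < Cn * \<Lambda> ^ r" using bound[of r] by (simp only: G_def \<mu>_def \<Lambda>_def)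
    moreover have "1 * \<mu> r \<le> Max ?S * \<mu> r" "G r * \<mu> r \<le> Max ?S * \<mu> r"
      using \<mu>[of r] by (intro mult_right_mono Max_ge; simp)+
    ultimately show "1 * \<mu> r \<le> Cn * \<Lambda> ^ r" "G r * \<mu> r \<le> Cn * \<Lambda> ^ r" by linarith+
  qed
  \<comment> \<open>At \<open>r = 0\<close> the gcd is 1 and the denominator at least 1. The bound
    enters \<open>2 * l0 * E \<ge> 1\<close> at the end.\<close>
  have C1: "Cn \<ge> 1"
  proof -
    have "\<mu> 0 \<ge> 1" using hyp_D_props[of n 0] by (simp add: \<mu>_def hyp_N_degree_0)
    then show ?thesis using \<mu>1[of 0] by simp
  qed
  have C\<Lambda>: "Cn * \<Lambda> ^ r \<ge> 0" for r using C \<Lambda> by simp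
  define pr where "pr = (\<lambda>r. of_real (\<mu> r) * (b ^ r * pade_poly \<nu> r (a / b)))"
  define qr where "qr = (\<lambda>r. of_real (\<mu> r) * (a ^ r * pade_poly \<nu> r (b / a)))"
  have aK: "a \<in> K" "b \<in> K" using a b by (auto simp: ring_of_integers_def)
  have dK: "of_nat d \<in> K"
    using ring_of_integers_of_int[OF sub, of "int d"] by (simp add: ring_of_integers_def)
  have y1: "(a - b) / of_nat d \<in> ring_of_integers K"
    using dvd aK dK is_subfieldD[OF sub] unfolding ring_of_integers_def
    by (auto simp: divide_inverse diff_conv_add_uminus simp del: add_uminus_conv_diff)
  have y2: "(b - a) / of_nat d \<in> ring_of_integers K"
    using ring_of_integers_diff[OF sub ring_of_integers_of_int[OF sub, of 0] y1] by (simp only: of_int_0 diff_0 minus_divide_left minus_diff_eq)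
  have n2: "n \<ge> 2" using n by simp
  \<comment> \<open>Both sequences are brought to the factor \<open>b^r\<close>, so their
    determinant is a nonzero multiple of the polynomial one at \<open>x\<close>.\<close>
  have Yq: "a ^ r * pade_poly \<nu> r (b / a) = b ^ r * poly (pade_Y \<nu> r) x" for r
    using a0 b0 by (simp add: poly_pade_Y x_def power_divide)
  have Xp: "b ^ r * pade_poly \<nu> r (a / b) = b ^ r * poly (pade_X \<nu> r) x" for r
    by (simp add: poly_pade_X x_def)
  \<comment> \<open>Then \<open>2 * l0 * E\<close> is the base of the power in \<open>c\<close>,
    because \<open>a * (a - b) / b = a * (x - 1)\<close>.\<close>
  define l0 where "l0 = 5 / 4 * cmod a * cmod (x - 1) * Cn"
  have "cmod (\<theta> - p / q) > 1 / (2 * (2 * cmod a * Cn) * Q * (2 * l0 * E) powr \<kappa> * cmod q powr (\<kappa> + 1))"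
  proof (rule irrationality_measure_from_approximations[OF sub norm1, where p = pr and q = qr])
    show "pr r \<in> ring_of_integers K" for r
      unfolding pr_def \<mu>_def \<nu>_def by (rule pade_value_integral[OF sub n2 d b b0 y2])
    show "qr r \<in> ring_of_integers K" for r
      unfolding qr_def \<mu>_def \<nu>_def by (rule pade_value_integral[OF sub n2 d a a0 y1])
    show "pr r * qr (Suc r) \<noteq> pr (Suc r) * qr r" for r
    proof -
      let ?c = "of_real (\<mu> r) * of_real (\<mu> (Suc r)) * (b ^ r * b ^ Suc r)"
      have "?c \<noteq> 0" using b0 \<mu>[of r] \<mu>[of "Suc r"] by simp
      moreover have "pr r * qr (Suc r) = ?c * (poly (pade_X \<nu> r) x * poly (pade_Y \<nu> (Suc r)) x)"
        "pr (Suc r) * qr r = ?c * (poly (pade_X \<nu> (Suc r)) x * poly (pade_Y \<nu> r) x)"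
        unfolding pr_def qr_def Yq Xp by (simp_all only: mult_ac)
      ultimately show ?thesis using pade_det_nonzero[OF \<nu>(1,3) x1, of r]
        by (simp only: mult_cancel_left simp_thms)
    qed
    show "cmod (qr r) \<le> (2 * cmod a * Cn) * Q ^ r" for r
    proof -
      have "b / a = exp (- L)" by (simp add: exp_minus L(1) x_def)
      then have "qr r = of_real (\<mu> r) * (a ^ r * (of_real (pade_gamma \<nu> r) * pade_prim \<nu> r (- L) 0))"
        using pade_poly_eq_prim_0[OF \<nu>(1,3), of r "- L"] by (simp only: qr_def)
      then have "cmod (qr r) = \<mu> r * (cmod a ^ r * (pade_gamma \<nu> r * cmod (pade_prim \<nu> r (- L) 0)))"
        using \<mu>[of r] pade_gamma_pos[OF \<nu>(1), of r] by (simp add: norm_mult norm_power)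
      also have "\<dots> = (G r * \<mu> r) * (cmod a ^ r * (\<nu> * cmod (pade_prim \<nu> r (- L) 0)))"
        by (simp only: \<gamma> mult_ac)
      also have "\<dots> \<le> (Cn * \<Lambda> ^ r) * (cmod a ^ r * (2 * cmod a * (cmod (1 + exp (- L / 2)))\<^sup>2 ^ r))"
        using \<nu> by (intro mult_mono \<mu>G est2 C\<Lambda>) auto
      also have "\<dots> = (2 * cmod a * Cn) * Q ^ r"
        by (simp add: Q M2_def power_mult_distrib mult_ac)
      finally show ?thesis .
    qed
    show "cmod (\<theta> * qr r - pr r) \<le> l0 / E ^ r" for r
    proof -
      have "\<theta> * qr r - pr r = of_real (\<mu> r) * (b ^ r * (\<theta> * poly (pade_Y \<nu> r) x - poly (pade_X \<nu> r) x))"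
        unfolding qr_def pr_def Yq Xp by (simp add: algebra_simps)
      also have "\<theta> * poly (pade_Y \<nu> r) x - poly (pade_X \<nu> r) x =
          of_real (pade_gamma \<nu> r) * (pade_prim \<nu> r L L - pade_prim \<nu> r L 0)"
        unfolding \<theta> L(1)[symmetric] by (rule pade_remainder[OF \<nu>(1,3)])
      finally have "cmod (\<theta> * qr r - pr r) =
          \<mu> r * (cmod b ^ r * (pade_gamma \<nu> r * cmod (pade_prim \<nu> r L L - pade_prim \<nu> r L 0)))"
        using \<mu>[of r] pade_gamma_pos[OF \<nu>(1), of r] by (simp add: norm_mult norm_power)
      also have "\<dots> = (G r * \<mu> r) * (cmod b ^ r * (\<nu> * cmod (pade_prim \<nu> r L L - pade_prim \<nu> r L 0)))"
        by (simp only: \<gamma> mult_ac)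
      also have "\<dots> \<le> (Cn * \<Lambda> ^ r) * (cmod b ^ r * (5 / 4 * cmod a * cmod (x - 1) * (cmod (1 - exp (L / 2)))\<^sup>2 ^ r))"
        using \<nu> by (intro mult_mono \<mu>G est1 C\<Lambda>) auto
      also have "\<dots> = l0 * (\<Lambda> * m2) ^ r"
        by (simp add: l0_def m2_def power_mult_distrib mult_ac)
      also have "\<dots> = l0 / E ^ r" by (simp add: E power_one_over)
      finally show ?thesis .
    qed
    show "2 * cmod a * Cn > 0" using C a0 by simp
    show "l0 > 0" using C a0 x1 by (simp add: l0_def)
    have "m2 > 0"
    proof -
      \<comment> \<open>As \<open>1 / 0 = 0\<close>, a vanishing \<open>m2\<close> would give
        \<open>E = 0\<close>.\<close>
      have "m2 \<noteq> 0" using E E1 by auto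
      then show ?thesis by (simp add: m2_def zero_less_mult_iff)
    qed
    show "Q > 0"
    proof -
      \<comment> \<open>Otherwise \<open>exp (L / 2) = - 1\<close>, contrary to its nonnegative real
        part.\<close>
      have "(cmod (1 + exp (- L / 2)))\<^sup>2 \<noteq> 0"
      proof
        assume "(cmod (1 + exp (- L / 2)))\<^sup>2 = 0"
        then have "exp (- L / 2) = - 1" by (simp add: eq_neg_iff_add_eq_0 add.commute)
        then have "exp (L / 2) = - 1" using exp_minus[of "- L / 2"] by simp
        then show False using L(3) by simp
      qed
      then show ?thesis using \<Lambda> a0 by (simp add: Q M2_def)
    qed
    \<comment> \<open>Since \<open>a * (x - 1) = (a / b) * (a - b)\<close> and both factors have
      modulus at least 1, \<open>2 * l0 * E\<close> is a product of numbers not below 1.\<close>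
    have "cmod a \<ge> cmod b" using x_ge b0 by (simp add: x_def norm_divide field_simps)
    then have "1 * 1 \<le> (cmod a / cmod b) * cmod (a - b)"
      using nab b0 by (intro mult_mono) (auto simp: field_simps)
    moreover have "cmod a * cmod (x - 1) = (cmod a / cmod b) * cmod (a - b)"
    proof -
      have "x - 1 = (a - b) / b" using b0 by (simp add: x_def diff_divide_distrib)
      then show ?thesis by (simp add: norm_divide)
    qed
    ultimately have "1 \<le> cmod a * cmod (x - 1)" by simp
    then have "1 * 1 * 1 * 1 \<le> (5 / 2) * (cmod a * cmod (x - 1)) * Cn * E"
      using C1 E1 by (intro mult_mono) auto
    then show "2 * l0 * E \<ge> 1" by (simp add: l0_def mult_ac)
  qed (use E1 assms(17) p q in auto)
  moreover have "2 * (2 * cmod a * Cn) * Q * (2 * l0 * E) powr \<kappa> = c"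
  proof -
    have "a * (a - b) / b = a * (x - 1)" using b0 by (simp add: x_def field_simps)
    then show ?thesis unfolding assms(18) by (simp add: l0_def norm_mult mult_ac)
  qed
  ultimately show "cmod (princ_root n (a / b) - p / q) > 1 / (c * cmod q powr (\<kappa> + 1))"
    unfolding \<theta>_def x_def by simp
qed

end
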